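(* Fix $c>0$ and, for integers $n\geq c$, consider the core of the random graph $\mathrm{G_{Poi}}(n,\frac{c}{n})$. (1) If $c<1$, then all connected components of the core have size $o_{\mathbb{P}}(n)$ (i.e. the size of the largest connected component of the core is $o_{\mathbb{P}}(n)$). (2) If $c>1$, then the core contains a unique giant component, of size $\beta(c)n+o_{\mathbb{P}}(n)$, where $\beta(c)$ is the first positive root $t$ of $1-\mathrm{e}^{-ct}-t=0$, and all other connected components of the core have size $o_{\mathbb{P}}(n)$ (i.e. the largest component has size $\beta(c)n+o_{\mathbb{P}}(n)$ and the second largest component has size $o_{\mathbb{P}}(n)$).
   Context: For random variables $X_n$, $X_n=o_{\mathbb{P}}(n)$ means that $X_n/n\to 0$ in probability as $n\to\infty$. The size of a component is its number of vertices (with size $0$ if there is no such component). $\mathcal{P}(\alpha)$ denotes the Poisson law of expectation $\alpha$. $G(N,p)$ is the Erdős–Rényi random graph on $N$ vertices in which each of the $\binom{N}{2}$ edges is present independently with probability $p$. Definition of $\mathrm{G_{Poi}}(\alpha,p)$ ($\alpha>0$, $p\in[0,1]$): let $N\sim\mathcal{P}(\alpha)$. Conditionally on $N$, the graph consists of a $G(N,p)$ random graph, called the core, together with a countably infinite collection of additional vertices, called the stack; each pair (stack vertex, core vertex) is joined by an edge independently with probability $p$, independently also of the edges of the core. There is no edge between vertices of the stack. In particular, the core of $\mathrm{G_{Poi}}(n,\frac{c}{n})$ is a $G(N,\frac{c}{n})$ random graph with $N\sim\mathcal{P}(n)$ random, and connected components of the core are those of this graph (the stack vertices being ignored). *)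

theory Defs
  imports "HOL-Probability.Probability" "HOL-Library.More_List"
begin

section \<open>Convergence in probability\<close>

text \<open>
  The \<open>n\<close>-th variable lives on its own probability space \<open>M n\<close>.
\<close>

definition tendsto_in_probability :: "(nat \<Rightarrow> 'a measure) \<Rightarrow> (nat \<Rightarrow> 'a \<Rightarrow> real) \<Rightarrow> real \<Rightarrow> bool" where
  "tendsto_in_probability M X l \<longleftrightarrow>
     (\<forall>n. prob_space (M n) \<and> X n \<in> borel_measurable (M n)) \<and>
     (\<forall>\<epsilon>>0. (\<lambda>n. measure (M n) {\<omega> \<in> space (M n). \<bar>X n \<omega> - l\<bar> > \<epsilon>}) \<longlonglongrightarrow> 0)"

definition small_o_in_probability :: "(nat \<Rightarrow> 'a measure) \<Rightarrow> (nat \<Rightarrow> 'a \<Rightarrow> real) \<Rightarrow> bool" where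
  "small_o_in_probability M X \<longleftrightarrow> tendsto_in_probability M (\<lambda>n \<omega>. X n \<omega> / real n) 0"


section \<open>Simple graphs and component sizes\<close>

text \<open>
  A graph is a pair of a vertex set and a set of edges, an edge being a two-element set of vertices.
\<close>

type_synonym 'v graph = "'v set \<times> 'v set set"

definition induced_subgraph :: "'v graph \<Rightarrow> 'v set \<Rightarrow> 'v graph" where
  "induced_subgraph G W = (fst G \<inter> W, {e \<in> snd G. e \<subseteq> W})"

definition adjacency :: "'v graph \<Rightarrow> ('v \<times> 'v) set" where
  "adjacency G = {(u, v). u \<in> fst G \<and> v \<in> fst G \<and> {u, v} \<in> snd G}"

definition components :: "'v graph \<Rightarrow> 'v set set" where
  "components G = fst G // (adjacency G)\<^sup>*"

text \<open>
  The size of the \<open>k\<close>-th largest component, with \<open>k = 1\<close> for the largest; sizes are ranked with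
  multiplicity, so two largest components of equal size occupy the ranks \<open>1\<close> and \<open>2\<close>. The value is
  \<open>0\<close> if there are fewer than \<open>k\<close> components. This is meaningful for finite vertex sets only,
  because of \<^const>\<open>mset_set\<close> and \<^const>\<open>card\<close>.
\<close>

definition component_size :: "nat \<Rightarrow> 'v graph \<Rightarrow> nat" where
  "component_size k G =
     nth_default 0 (rev (sorted_list_of_multiset (image_mset card (mset_set (components G))))) (k - 1)"


section \<open>The random graphs\<close>

definition vertex_pairs :: "nat \<Rightarrow> nat set set" where
  "vertex_pairs N = {e. e \<subseteq> {..<N} \<and> card e = 2}"

text \<open>The edge set of \<open>G(N, p)\<close> on the vertices \<open>{..<N}\<close>.\<close>

definition erdos_renyi_pmf :: "nat \<Rightarrow> real \<Rightarrow> nat set set pmf" where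
  "erdos_renyi_pmf N p =
     map_pmf (\<lambda>b. {e \<in> vertex_pairs N. b e})
       (Pi_pmf (vertex_pairs N) False (\<lambda>_. bernoulli_pmf p))"

datatype vertex = Core nat | Stack nat

text \<open>
  A sample point is \<open>((N, E), S)\<close>, where \<open>E\<close> is the edge set of the core and \<open>S (s, v)\<close> tells whether
  stack vertex \<open>s\<close> is joined to core vertex \<open>v\<close>. The family \<open>S\<close> is drawn for all natural numbers \<open>v\<close>,
  independently of \<open>(N, E)\<close>, but only its entries with \<open>v < N\<close> enter the graph. Hence, conditionally on
  \<open>N\<close>, the core is a \<open>G(N, p)\<close> graph and the pairs of a stack vertex and a core vertex are joined
  independently with probability \<open>p\<close>, and independently of \<open>E\<close>.
\<close>

type_synonym gpoi_sample = "(nat \<times> nat set set) \<times> (nat \<times> nat \<Rightarrow> bool)"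

definition gpoi_space :: "real \<Rightarrow> real \<Rightarrow> gpoi_sample measure" where
  "gpoi_space \<alpha> p =
     measure_pmf (bind_pmf (poisson_pmf \<alpha>) (\<lambda>N. map_pmf (Pair N) (erdos_renyi_pmf N p)))
     \<Otimes>\<^sub>M (\<Pi>\<^sub>M i\<in>UNIV. measure_pmf (bernoulli_pmf p))"

fun gpoi_graph :: "gpoi_sample \<Rightarrow> vertex graph" where
  "gpoi_graph ((N, E), S) =
     (Core ` {..<N} \<union> range Stack,
      (`) Core ` E \<union> {{Stack s, Core v} | s v. v < N \<and> S (s, v)})"

definition core :: "vertex graph \<Rightarrow> vertex graph" where
  "core G = induced_subgraph G (range Core)"

definition core_component_size :: "nat \<Rightarrow> gpoi_sample \<Rightarrow> real" where
  "core_component_size k \<omega> = real (component_size k (core (gpoi_graph \<omega>)))"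


section \<open>The giant fraction\<close>

definition giant_fraction :: "real \<Rightarrow> real" where
  "giant_fraction c = (LEAST t. 0 < t \<and> 1 - exp (- c * t) - t = 0)"

end

theory Submission
  imports Defs
begin

text \<open>
  Call a set of vertices closed if no edge leaves it. In the core with intensity \<open>\<alpha>\<close>, the expected
  number of closed sets of size \<open>m\<close> whose induced subgraph has a given property is
  \<open>\<alpha>\<^sup>m / m! * exp (- \<alpha> (1 - q\<^sup>m))\<close>, with \<open>q = 1 - p\<close>, times the probability of that property in
  \<open>G(m, p)\<close>; given such a set, the other vertices form a core of intensity \<open>\<alpha> q\<^sup>m\<close>. Hence
  expectations at two intensities are proportional with an explicit factor, and an expectation at
  intensity \<open>n\<close> can be bounded by a trivial bound at a better chosen intensity.

  Choosing \<open>\<alpha> = m / (1 - q\<^sup>m)\<close>, and since a graph on \<open>N\<close> vertices has at most \<open>(1 + 1 / K)\<^sup>N\<close> unions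
  of components of size at least \<open>K\<close>, the expected number of such unions of size \<open>m\<close> is at most
  \<open>exp (- m h(x) + \<alpha> / K)\<close>, where \<open>x = n (1 - q\<^sup>m) / m\<close> and \<open>h(x) = x - 1 - ln x\<close>. For large \<open>K\<close> this
  excludes all sizes \<open>m \<ge> \<epsilon> n\<close> except, if \<open>c > 1\<close>, those close to \<open>\<beta> n\<close>.

  For \<open>c > 1\<close>, comparison with the dual intensity \<open>(1 - \<beta>) n\<close> shows that components of size
  less than \<open>K\<close> have expected total size at most about \<open>(1 - \<beta>) n\<close>, and their total size concentrates by
  the second moment method. So the components of size at least \<open>K\<close> cover about \<open>\<beta> n\<close> vertices; if all of
  them were smaller than \<open>\<epsilon> n\<close>, adding them one by one would produce a union of an excluded size.
\<close>

section \<open>Components and closed vertex sets\<close>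

definition pairs :: "'v set \<Rightarrow> 'v set set" where
  "pairs V = {e. e \<subseteq> V \<and> card e = 2}"

text \<open>When all edges are pairs of vertices, these are exactly the unions of components. The
  condition only asks that certain edges be absent, so its probability follows from independence of
  the edges.\<close>

definition closed_in :: "'v graph \<Rightarrow> 'v set \<Rightarrow> bool" where
  "closed_in G A \<longleftrightarrow> A \<subseteq> fst G \<and> (\<forall>e\<in>snd G. e \<subseteq> A \<or> e \<inter> A = {})"

lemma finite_pairs: "finite V \<Longrightarrow> finite (pairs V)"
  by (rule finite_subset[of _ "Pow V"]) (auto simp: pairs_def)

lemma components_eq_image: "components G = (\<lambda>u. (adjacency G)\<^sup>* `` {u}) ` fst G"
  by (auto simp: components_def quotient_def)

lemma equiv_adjacency: "equiv UNIV ((adjacency G)\<^sup>*)"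
proof (rule equivI)
  have "sym (adjacency G)"
    by (auto simp: sym_def adjacency_def insert_commute)
  then show "sym ((adjacency G)\<^sup>*)" by (rule sym_rtrancl)
qed (auto simp: refl_rtrancl trans_rtrancl)

lemma adjacency_rtrancl_in:
  assumes "(u, v) \<in> (adjacency G)\<^sup>*" "u \<in> fst G"
  shows "v \<in> fst G"
  using assms by (induction rule: rtrancl_induct) (auto simp: adjacency_def)

lemma component_subset: "C \<in> components G \<Longrightarrow> C \<subseteq> fst G"
  by (auto simp: components_eq_image intro: adjacency_rtrancl_in)

lemma component_nonempty: "C \<in> components G \<Longrightarrow> C \<noteq> {}"
  by (auto simp: components_eq_image)

lemma Union_components: "\<Union>(components G) = fst G"
proof
  show "\<Union>(components G) \<subseteq> fst G" using component_subset by blast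
  show "fst G \<subseteq> \<Union>(components G)" by (auto simp: components_eq_image)
qed

lemma components_disjoint:
  assumes "C \<in> components G" "D \<in> components G" "C \<noteq> D"
  shows "C \<inter> D = {}"
proof -
  have "C \<in> UNIV // (adjacency G)\<^sup>*" "D \<in> UNIV // (adjacency G)\<^sup>*"
    using assms by (auto simp: components_def quotient_def)
  from quotient_disj[OF equiv_adjacency this] assms show ?thesis by auto
qed

lemma finite_components: "finite (fst G) \<Longrightarrow> finite (components G)"
  by (simp add: components_eq_image)

lemma finite_component: "finite (fst G) \<Longrightarrow> C \<in> components G \<Longrightarrow> finite C"
  using component_subset finite_subset by blast

lemma card_Union_components:
  assumes "finite (fst G)" "\<C> \<subseteq> components G"
  shows "card (\<Union>\<C>) = (\<Sum>C\<in>\<C>. card C)"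
proof (rule card_Union_disjoint)
  show "disjoint \<C>"
    unfolding pairwise_def disjnt_def using components_disjoint assms(2) by blast
  show "\<And>C. C \<in> \<C> \<Longrightarrow> finite C"
    using finite_component[OF assms(1)] assms(2) by auto
qed

lemma closed_inD: "closed_in G A \<Longrightarrow> e \<in> snd G \<Longrightarrow> e \<subseteq> A \<or> e \<inter> A = {}"
  unfolding closed_in_def by blast

lemma closed_in_subset: "closed_in G A \<Longrightarrow> A \<subseteq> fst G"
  unfolding closed_in_def by blast

lemma finite_closed_in:
  assumes "finite (fst G)"
  shows "finite {A. closed_in G A \<and> P A}"
proof (rule finite_subset)
  show "{A. closed_in G A \<and> P A} \<subseteq> Pow (fst G)" by (auto dest: closed_in_subset)
qed (simp add: assms)

lemma closed_in_rtrancl: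
  assumes "closed_in G A" "(u, v) \<in> (adjacency G)\<^sup>*" "u \<in> A"
  shows "v \<in> A"
  using assms(2,3)
proof (induction rule: rtrancl_induct)
  case (step y z)
  then have "{y, z} \<in> snd G" by (auto simp: adjacency_def)
  from closed_inD[OF assms(1) this] have "{y, z} \<subseteq> A \<or> {y, z} \<inter> A = {}" .
  with step show ?case by auto
qed auto

lemma closed_in_component:
  assumes "snd G \<subseteq> pairs (fst G)" "C \<in> components G"
  shows "closed_in G C"
proof -
  obtain u where u: "u \<in> fst G" "C = (adjacency G)\<^sup>* `` {u}"
    using assms(2) by (auto simp: components_eq_image)
  have "e \<subseteq> C" if e: "e \<in> snd G" "e \<inter> C \<noteq> {}" for e
  proof
    fix y assume y: "y \<in> e"
    obtain x where x: "x \<in> e" "x \<in> C" using e by auto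
    from e assms(1) have e2: "card e = 2" "e \<subseteq> fst G" by (auto simp: pairs_def)
    show "y \<in> C"
    proof (cases "x = y")
      case False
      then have "e = {x, y}"
        using e2 x y by (auto simp: card_2_iff)
      then have "(x, y) \<in> adjacency G" using e e2 by (auto simp: adjacency_def)
      with x u show ?thesis by (auto intro: rtrancl_into_rtrancl)
    qed (use x in auto)
  qed
  then show ?thesis using component_subset[OF assms(2)] by (auto simp: closed_in_def)
qed

lemma closed_in_Union:
  assumes "snd G \<subseteq> pairs (fst G)" "\<C> \<subseteq> components G"
  shows "closed_in G (\<Union>\<C>)"
proof -
  have *: "\<And>C. C \<in> \<C> \<Longrightarrow> closed_in G C"
    using closed_in_component[OF assms(1)] assms(2) by auto
  show ?thesis unfolding closed_in_def
  proof (intro conjI ballI)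
    show "\<Union>\<C> \<subseteq> fst G" using closed_in_subset[OF *] by auto
    fix e assume "e \<in> snd G"
    then have "e \<subseteq> C \<or> e \<inter> C = {}" if "C \<in> \<C>" for C
      using closed_inD[OF *[OF that]] by simp
    then show "e \<subseteq> \<Union>\<C> \<or> e \<inter> \<Union>\<C> = {}" by blast
  qed
qed

lemma closed_in_Diff:
  "snd G \<subseteq> pairs (fst G) \<Longrightarrow> closed_in G A \<Longrightarrow> closed_in G (fst G - A)"
  by (fastforce simp: closed_in_def pairs_def)

text \<open>A path that starts in a closed set never leaves it, so reachability from a point of
  \<open>A\<close> is the same in the induced graph and in the whole graph.\<close>

lemma components_closed_in:
  assumes E: "E \<subseteq> pairs V" and A: "closed_in (V, E) A"
  shows "components (A, E \<inter> pairs A) = {C \<in> components (V, E). C \<subseteq> A}"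
proof -
  have AV: "A \<subseteq> V" using A by (auto simp: closed_in_def)
  have sub: "adjacency (A, E \<inter> pairs A) \<subseteq> adjacency (V, E)"
    using AV by (auto simp: adjacency_def)
  have eq: "(adjacency (A, E \<inter> pairs A))\<^sup>* `` {u} = (adjacency (V, E))\<^sup>* `` {u}" if u: "u \<in> A" for u
  proof
    show "(adjacency (A, E \<inter> pairs A))\<^sup>* `` {u} \<subseteq> (adjacency (V, E))\<^sup>* `` {u}"
      using rtrancl_mono[OF sub] by auto
    show "(adjacency (V, E))\<^sup>* `` {u} \<subseteq> (adjacency (A, E \<inter> pairs A))\<^sup>* `` {u}"
    proof (rule subsetI)
      fix v assume "v \<in> (adjacency (V, E))\<^sup>* `` {u}"
      then have "(u, v) \<in> (adjacency (V, E))\<^sup>*" by simp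
      then show "v \<in> (adjacency (A, E \<inter> pairs A))\<^sup>* `` {u}"
      proof (induction rule: rtrancl_induct)
        case (step y z)
        from closed_in_rtrancl[OF A] step u have "y \<in> A" "z \<in> A"
          by (auto intro: rtrancl_into_rtrancl)
        then have "(y, z) \<in> adjacency (A, E \<inter> pairs A)"
          using step E by (auto simp: adjacency_def pairs_def)
        with step show ?case by (auto intro: rtrancl_into_rtrancl)
      qed auto
    qed
  qed
  have "components (A, E \<inter> pairs A) = (\<lambda>u. (adjacency (V, E))\<^sup>* `` {u}) ` A"
    using eq by (auto simp: components_eq_image)
  also have "\<dots> = {C \<in> components (V, E). C \<subseteq> A}"
    using AV closed_in_rtrancl[OF A] by (auto simp: components_eq_image)
  finally show ?thesis .
qed

text \<open>The component of a point of \<open>A\<close> stays inside \<open>A\<close>. Together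
  with \<open>closed_in_Union\<close> this identifies closed sets with unions of components.\<close>

lemma closed_in_eq_Union:
  assumes "closed_in G A"
  shows "A = \<Union>{C \<in> components G. C \<subseteq> A}"
proof
  show "A \<subseteq> \<Union>{C \<in> components G. C \<subseteq> A}"
  proof
    fix u assume u: "u \<in> A"
    let ?C = "(adjacency G)\<^sup>* `` {u}"
    have "?C \<in> components G" using u assms by (auto simp: components_eq_image closed_in_def)
    moreover have "?C \<subseteq> A" using closed_in_rtrancl[OF assms] u by auto
    ultimately show "u \<in> \<Union>{C \<in> components G. C \<subseteq> A}" by auto
  qed
qed auto

section \<open>Relabelling of vertices\<close>

lemma components_image:
  assumes inj: "inj_on \<sigma> V" and E: "E \<subseteq> Pow V"
  shows "components (\<sigma> ` V, (`) \<sigma> ` E) = (`) \<sigma> ` components (V, E)"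
proof -
  have adj: "(\<sigma> u, \<sigma> v) \<in> adjacency (\<sigma> ` V, (`) \<sigma> ` E) \<longleftrightarrow> (u, v) \<in> adjacency (V, E)"
    if "u \<in> V" "v \<in> V" for u v
  proof -
    have "{\<sigma> u, \<sigma> v} \<in> (`) \<sigma> ` E \<longleftrightarrow> {u, v} \<in> E"
    proof
      assume "{\<sigma> u, \<sigma> v} \<in> (`) \<sigma> ` E"
      then obtain e where e: "e \<in> E" "\<sigma> ` e = \<sigma> ` {u, v}" by auto
      with E have "e \<subseteq> V" by auto
      with e that inj have "e = {u, v}" by (subst (asm) inj_on_image_eq_iff[of \<sigma> V]) auto
      with e show "{u, v} \<in> E" by simp
    next
      assume "{u, v} \<in> E"
      then have "\<sigma> ` {u, v} \<in> (`) \<sigma> ` E" by (rule imageI)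
      then show "{\<sigma> u, \<sigma> v} \<in> (`) \<sigma> ` E" by simp
    qed
    with that show ?thesis by (auto simp: adjacency_def)
  qed
  have "(adjacency (\<sigma> ` V, (`) \<sigma> ` E))\<^sup>* `` {\<sigma> u} = \<sigma> ` ((adjacency (V, E))\<^sup>* `` {u})"
    if u: "u \<in> V" for u
  proof
    show "(adjacency (\<sigma> ` V, (`) \<sigma> ` E))\<^sup>* `` {\<sigma> u} \<subseteq> \<sigma> ` ((adjacency (V, E))\<^sup>* `` {u})"
    proof (rule subsetI)
      fix y assume "y \<in> (adjacency (\<sigma> ` V, (`) \<sigma> ` E))\<^sup>* `` {\<sigma> u}"
      then have "(\<sigma> u, y) \<in> (adjacency (\<sigma> ` V, (`) \<sigma> ` E))\<^sup>*" by simp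
      then show "y \<in> \<sigma> ` ((adjacency (V, E))\<^sup>* `` {u})"
      proof (induction rule: rtrancl_induct)
        case (step y z)
        then obtain v where v: "y = \<sigma> v" "(u, v) \<in> (adjacency (V, E))\<^sup>*" by auto
        have "v \<in> V" using adjacency_rtrancl_in[OF v(2)] u by auto
        moreover obtain w where w: "z = \<sigma> w" "w \<in> V" using step by (auto simp: adjacency_def)
        ultimately have "(v, w) \<in> adjacency (V, E)" using step adj v by auto
        with v(2) have "(u, w) \<in> (adjacency (V, E))\<^sup>*" by (rule rtrancl_into_rtrancl)
        with w show ?case by auto
      qed auto
    qed
    show "\<sigma> ` ((adjacency (V, E))\<^sup>* `` {u}) \<subseteq> (adjacency (\<sigma> ` V, (`) \<sigma> ` E))\<^sup>* `` {\<sigma> u}"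
    proof (rule image_subsetI)
      fix v assume "v \<in> (adjacency (V, E))\<^sup>* `` {u}"
      then have "(u, v) \<in> (adjacency (V, E))\<^sup>*" by simp
      then show "\<sigma> v \<in> (adjacency (\<sigma> ` V, (`) \<sigma> ` E))\<^sup>* `` {\<sigma> u}"
      proof (induction rule: rtrancl_induct)
        case (step y z)
        have "y \<in> V" "z \<in> V" using step by (auto simp: adjacency_def)
        with step adj have "(\<sigma> y, \<sigma> z) \<in> adjacency (\<sigma> ` V, (`) \<sigma> ` E)" by auto
        with step show ?case by (auto intro: rtrancl_into_rtrancl)
      qed auto
    qed
  qed
  then show ?thesis
    unfolding components_eq_image fst_conv image_image by (intro image_cong) auto
qed

lemma image_card_components_image:
  assumes inj: "inj_on \<sigma> V" and E: "E \<subseteq> Pow V"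
  shows "card ` components (\<sigma> ` V, (`) \<sigma> ` E) = card ` components (V, E)"
proof -
  have "card (\<sigma> ` C) = card C" if "C \<in> components (V, E)" for C
    using component_subset[OF that] inj by (intro card_image) (auto intro: inj_on_subset)
  then show ?thesis unfolding components_image[OF assms] by (force simp: image_image)
qed

lemma component_size_image:
  assumes inj: "inj_on \<sigma> V" and E: "E \<subseteq> Pow V"
  shows "component_size k (\<sigma> ` V, (`) \<sigma> ` E) = component_size k (V, E)"
proof -
  have "inj_on ((`) \<sigma>) (components (V, E))"
    using inj component_subset[of _ "(V, E)"] by (auto simp: inj_on_def inj_on_image_eq_iff[OF inj])
  then have "mset_set (components (\<sigma> ` V, (`) \<sigma> ` E)) = image_mset ((`) \<sigma>) (mset_set (components (V, E)))"
    unfolding components_image[OF assms] by (rule image_mset_mset_set[symmetric])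
  moreover have "card (\<sigma> ` C) = card C" if "C \<in> components (V, E)" for C
    using component_subset[OF that] inj by (intro card_image) (auto intro: inj_on_subset)
  then have "image_mset (\<lambda>C. card (\<sigma> ` C)) (mset_set (components (V, E))) = image_mset card (mset_set (components (V, E)))"
    by (intro image_mset_cong)
       (metis elem_mset_set finite_set_mset_mset_set infinite_set_mset_mset_set empty_iff)
  ultimately show ?thesis by (simp add: component_size_def multiset.map_comp comp_def)
qed

section \<open>Ranked component sizes\<close>

text \<open>The size list is read in decreasing order, so if its entry of index \<open>k - 1\<close>
  exceeds \<open>x\<close>, then so do all \<open>k\<close> entries of index below
  \<open>k\<close>.\<close>

lemma card_components_gt_le:
  assumes "finite (fst G)" "x < component_size k G" "1 \<le> k"
  shows "k \<le> card {C \<in> components G. x < card C}"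
proof -
  define M where "M = image_mset card (mset_set (components G))"
  define xs where "xs = rev (sorted_list_of_multiset M)"
  have xs: "mset xs = M" "sorted (rev xs)" by (simp_all add: xs_def)
  have nth: "nth_default 0 xs (k - 1) > x" using assms(2) by (simp add: component_size_def xs_def M_def)
  \<comment> \<open>The default value 0 of \<open>nth_default\<close> cannot exceed
    \<open>x\<close>, so the index lies within the list.\<close>
  then have len: "k - 1 < length xs" and nth: "xs ! (k - 1) > x"
    by (auto simp: nth_default_def split: if_splits)
  have "x < xs ! i" if "i < k" for i
    using less_le_trans[OF nth sorted_rev_nth_mono[OF xs(2) _ len, of i]] that by simp
  then have "{..<k} \<subseteq> {i. i < length xs \<and> x < xs ! i}" using len by auto
  from card_mono[OF _ this] have "k \<le> card {i. i < length xs \<and> x < xs ! i}" by simp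
  also have "\<dots> = length (filter (\<lambda>y. x < y) xs)" by (simp add: length_filter_conv_card)
  also have "\<dots> = size (filter_mset (\<lambda>y. x < y) M)" by (simp add: xs(1)[symmetric] mset_filter[symmetric] del: mset_filter)
  also have "\<dots> = card {C \<in> components G. x < card C}"
    using finite_components[OF assms(1)] by (simp add: M_def filter_mset_image_mset)
  finally show ?thesis .
qed

text \<open>At most \<open>card \<D>\<close> components exceed \<open>x\<close>, fewer than rank
  \<open>k\<close> would require. This serves with \<open>\<D>\<close> empty for the largest
  component and with \<open>\<D>\<close> the giant alone for the second largest.\<close>

lemma component_size_le:
  assumes "finite (fst G)" "\<D> \<subseteq> components G" "card \<D> < k"
    and le: "\<And>C. C \<in> components G - \<D> \<Longrightarrow> card C \<le> x"
  shows "component_size k G \<le> x"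
proof (rule ccontr)
  assume "\<not> component_size k G \<le> x"
  then have "k \<le> card {C \<in> components G. x < card C}"
    using card_components_gt_le[of G x k] assms by simp
  also have "\<dots> \<le> card \<D>"
  proof (rule card_mono)
    show "finite \<D>" using finite_components[OF assms(1)] assms(2) by (rule finite_subset[rotated])
    show "{C \<in> components G. x < card C} \<subseteq> \<D>" using le by (auto simp: not_le[symmetric])
  qed
  finally show False using assms(3) by simp
qed

lemma component_size_1_ge:
  assumes "finite (fst G)" "C \<in> components G"
  shows "card C \<le> component_size 1 G"
proof -
  define M where "M = image_mset card (mset_set (components G))"
  define ys where "ys = sorted_list_of_multiset M"
  have ys: "mset ys = M" "sorted ys" by (simp_all add: ys_def)
  have "card C \<in># M" using assms finite_components[OF assms(1)] by (simp add: M_def)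
  then have C: "card C \<in> set ys" by (simp flip: ys(1))
  then have "ys \<noteq> []" by auto
  then have "component_size 1 G = last ys"
    by (simp add: component_size_def nth_default_def rev_nth last_conv_nth flip: ys_def M_def)
  moreover obtain i where "i < length ys" "ys ! i = card C" using C by (auto simp: in_set_conv_nth)
  then have "card C \<le> last ys"
    using sorted_nth_mono[OF ys(2), of i "length ys - 1"] \<open>ys \<noteq> []\<close> by (simp add: last_conv_nth)
  ultimately show ?thesis by simp
qed

section \<open>Random edge sets\<close>

text \<open>The ground set is arbitrary because the edge set will be split into the pairs inside a
  vertex set, inside its complement, and across.\<close>

definition random_subset :: "'a set \<Rightarrow> real \<Rightarrow> 'a set pmf" where
  "random_subset P p = map_pmf (\<lambda>b. {e \<in> P. b e}) (Pi_pmf P False (\<lambda>_. bernoulli_pmf p))"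

lemma erdos_renyi_eq_random_subset: "erdos_renyi_pmf N p = random_subset (pairs {..<N}) p"
  by (simp add: erdos_renyi_pmf_def random_subset_def vertex_pairs_def pairs_def)

lemma set_random_subset: "set_pmf (random_subset P p) \<subseteq> Pow P"
  by (auto simp: random_subset_def)

lemma random_subset_Un:
  assumes "finite P" "finite Q" "P \<inter> Q = {}"
  shows "random_subset (P \<union> Q) p =
    map_pmf (\<lambda>(X, Y). X \<union> Y) (pair_pmf (random_subset P p) (random_subset Q p))"
proof -
  have "{e \<in> P \<union> Q. if e \<in> P then f e else g e} = {e \<in> P. f e} \<union> {e \<in> Q. g e}" for f g :: "'a \<Rightarrow> bool"
    using assms(3) by auto
  then show ?thesis
    unfolding random_subset_def Pi_pmf_union[OF assms] map_pair[symmetric]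
    by (simp add: map_pmf_comp case_prod_unfold map_prod_def)
qed

lemma random_subset_singleton:
  "random_subset {e} p = map_pmf (\<lambda>b. if b then {e} else {}) (bernoulli_pmf p)"
  unfolding random_subset_def Pi_pmf_singleton map_pmf_comp
  by (intro map_pmf_cong) auto

lemma random_subset_image:
  assumes "finite P" "inj_on h P"
  shows "random_subset (h ` P) p = map_pmf ((`) h) (random_subset P p)"
  using assms
proof (induction rule: finite_induct)
  case empty
  then show ?case by (simp add: random_subset_def)
next
  case (insert e P)
  then have h: "h e \<notin> h ` P" by auto
  have "random_subset (h ` insert e P) p = random_subset ({h e} \<union> h ` P) p" by simp
  also have "\<dots> = map_pmf (\<lambda>(X, Y). X \<union> Y) (pair_pmf (random_subset {h e} p) (random_subset (h ` P) p))"
    using insert h by (intro random_subset_Un) auto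
  also have "random_subset {h e} p = map_pmf ((`) h) (random_subset {e} p)"
    unfolding random_subset_singleton map_pmf_comp by (intro map_pmf_cong) auto
  also have "random_subset (h ` P) p = map_pmf ((`) h) (random_subset P p)"
    using insert by simp
  also have "map_pmf (\<lambda>(X, Y). X \<union> Y) (pair_pmf (map_pmf ((`) h) (random_subset {e} p)) (map_pmf ((`) h) (random_subset P p)))
     = map_pmf ((`) h) (map_pmf (\<lambda>(X, Y). X \<union> Y) (pair_pmf (random_subset {e} p) (random_subset P p)))"
    unfolding map_pair[symmetric] by (simp add: map_pmf_comp case_prod_unfold map_prod_def image_Un)
  also have "map_pmf (\<lambda>(X, Y). X \<union> Y) (pair_pmf (random_subset {e} p) (random_subset P p)) = random_subset ({e} \<union> P) p"
    using insert by (intro random_subset_Un[symmetric]) auto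
  finally show ?case by simp
qed

lemma pmf_random_subset_empty:
  assumes "finite P" "0 \<le> p" "p \<le> 1"
  shows "pmf (random_subset P p) {} = (1 - p) ^ card P"
proof -
  have "(\<lambda>b. {e \<in> P. b e}) -` {{}} = Pi P (\<lambda>_. {False})" by (auto simp: vimage_def Pi_def)
  then have "pmf (random_subset P p) {} = measure (Pi_pmf P False (\<lambda>_. bernoulli_pmf p)) (Pi P (\<lambda>_. {False}))"
    by (simp add: random_subset_def pmf_map)
  also have "\<dots> = (\<Prod>x\<in>P. measure (measure_pmf (bernoulli_pmf p)) {False})"
    using assms by (intro measure_Pi_pmf_Pi) auto
  also have "\<dots> = (1 - p) ^ card P" using assms by (simp add: measure_pmf_single)
  finally show ?thesis .
qed

lemma pairs_image:
  assumes "inj_on \<sigma> A"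
  shows "pairs (\<sigma> ` A) = (`) \<sigma> ` pairs A"
proof
  show "pairs (\<sigma> ` A) \<subseteq> (`) \<sigma> ` pairs A"
  proof
    fix e assume "e \<in> pairs (\<sigma> ` A)"
    then have e: "e \<subseteq> \<sigma> ` A" "card e = 2" by (auto simp: pairs_def)
    then obtain f where f: "f \<subseteq> A" "e = \<sigma> ` f" by (auto simp: subset_image_iff)
    moreover have "card f = 2" using e f assms card_image[of \<sigma> f] inj_on_subset by metis
    ultimately show "e \<in> (`) \<sigma> ` pairs A" by (auto simp: pairs_def)
  qed
  show "(`) \<sigma> ` pairs A \<subseteq> pairs (\<sigma> ` A)"
    using assms by (auto simp: pairs_def card_image inj_on_subset)
qed

lemma inj_on_image_pairs: "inj_on \<sigma> A \<Longrightarrow> inj_on ((`) \<sigma>) (pairs A)"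
  by (auto simp: inj_on_def[of "(`) \<sigma>"] inj_on_image_eq_iff pairs_def)

section \<open>Splitting the vertex pairs along a vertex set\<close>

definition cross_pairs :: "'v set \<Rightarrow> 'v set \<Rightarrow> 'v set set" where
  "cross_pairs A B = (\<lambda>(a, b). {a, b}) ` (A \<times> B)"

lemma card_cross_pairs:
  assumes "A \<inter> B = {}"
  shows "card (cross_pairs A B) = card A * card B"
proof -
  have "inj_on (\<lambda>(a, b). {a, b}) (A \<times> B)"
    using assms by (auto simp: inj_on_def doubleton_eq_iff)
  then show ?thesis by (simp add: cross_pairs_def card_image card_cartesian_product)
qed

lemma pairs_Un:
  assumes "A \<inter> B = {}"
  shows "pairs (A \<union> B) = (pairs A \<union> pairs B) \<union> cross_pairs A B"
proof
  show "pairs (A \<union> B) \<subseteq> (pairs A \<union> pairs B) \<union> cross_pairs A B"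
  proof
    fix e assume "e \<in> pairs (A \<union> B)"
    then obtain x y where xy: "e = {x, y}" "x \<noteq> y" "x \<in> A \<union> B" "y \<in> A \<union> B"
      by (auto simp: pairs_def card_2_iff)
    have "e \<in> cross_pairs A B" if "(x \<in> A \<and> y \<in> B) \<or> (y \<in> A \<and> x \<in> B)"
      using that xy(1) by (auto simp: cross_pairs_def image_iff insert_commute)
    moreover have "e \<in> pairs A" if "x \<in> A" "y \<in> A" using that xy by (simp add: pairs_def)
    moreover have "e \<in> pairs B" if "x \<in> B" "y \<in> B" using that xy by (simp add: pairs_def)
    ultimately show "e \<in> (pairs A \<union> pairs B) \<union> cross_pairs A B" using xy(3,4) by blast
  qed
  have "card {a, b} = 2" if "a \<in> A" "b \<in> B" for a b
    using that assms by (cases "a = b") auto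
  then show "(pairs A \<union> pairs B) \<union> cross_pairs A B \<subseteq> pairs (A \<union> B)"
    by (auto simp: pairs_def cross_pairs_def)
qed

lemma pairs_disjoint:
  assumes "A \<inter> B = {}"
  shows "pairs A \<inter> pairs B = {}" "pairs A \<inter> cross_pairs A B = {}" "pairs B \<inter> cross_pairs A B = {}"
proof -
  show "pairs A \<inter> pairs B = {}"
  proof (rule ccontr)
    assume "pairs A \<inter> pairs B \<noteq> {}"
    then obtain e where "e \<subseteq> A" "e \<subseteq> B" "card e = 2" by (auto simp: pairs_def)
    then have "e = {}" using assms by auto
    with \<open>card e = 2\<close> show False by simp
  qed
qed (use assms in \<open>auto simp: pairs_def cross_pairs_def\<close>)

text \<open>The pairs inside \<open>A\<close>, inside \<open>V - A\<close> and across form disjoint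
  blocks, so their edge sets are independent. The set \<open>A\<close> is closed exactly when no
  pair across is an edge, which gives the power of \<open>1 - p\<close>.\<close>

lemma nn_integral_closed_in_split:
  fixes F H :: "'v set set \<Rightarrow> ennreal"
  assumes V: "finite V" and A: "A \<subseteq> V" and p: "0 \<le> p" "p \<le> 1"
  shows "(\<integral>\<^sup>+E. (if closed_in (V, E) A then F (E \<inter> pairs A) * H (E \<inter> pairs (V - A)) else 0) \<partial>random_subset (pairs V) p)
    = ennreal ((1 - p) ^ (card A * card (V - A))) *
      ((\<integral>\<^sup>+E. F E \<partial>random_subset (pairs A) p) * (\<integral>\<^sup>+E. H E \<partial>random_subset (pairs (V - A)) p))"
proof -
  define B where "B = V - A"
  have AB: "A \<inter> B = {}" "V = A \<union> B" using A by (auto simp: B_def)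
  have fin: "finite (pairs A)" "finite (pairs B)" "finite (cross_pairs A B)"
    using V A finite_subset[OF A V] by (auto simp: B_def finite_pairs cross_pairs_def)
  note dj = pairs_disjoint[OF AB(1)]
  have rs: "random_subset (pairs V) p = map_pmf (\<lambda>((X, Y), Z). X \<union> Y \<union> Z)
     (pair_pmf (pair_pmf (random_subset (pairs A) p) (random_subset (pairs B) p)) (random_subset (cross_pairs A B) p))"
    unfolding AB(2) pairs_Un[OF AB(1)]
    using fin dj by (subst random_subset_Un, simp, simp, blast, subst random_subset_Un)
      (simp_all add: map_pmf_comp case_prod_unfold pair_map_pmf1)
  \<comment> \<open>On the support of the three laws the integrand becomes a product of functions of
    the separate blocks; closedness turns into the indicator of \<open>Z = {}\<close>.\<close>
  have val: "(if closed_in (V, X \<union> Y \<union> Z) A then F ((X \<union> Y \<union> Z) \<inter> pairs A) * H ((X \<union> Y \<union> Z) \<inter> pairs B) else 0)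
     = F X * H Y * indicator {{}} Z"
    if XYZ: "X \<subseteq> pairs A" "Y \<subseteq> pairs B" "Z \<subseteq> cross_pairs A B" for X Y Z
  proof -
    have "closed_in (V, X \<union> Y \<union> Z) A \<longleftrightarrow> Z = {}"
    proof
      assume cl: "closed_in (V, X \<union> Y \<union> Z) A"
      show "Z = {}"
      proof (rule ccontr)
        assume "Z \<noteq> {}"
        then obtain e where "e \<in> Z" by auto
        with XYZ(3) obtain a b where ab: "e = {a, b}" "a \<in> A" "b \<in> B" by (auto simp: cross_pairs_def)
        from closed_inD[OF cl, of e] \<open>e \<in> Z\<close> have "e \<subseteq> A \<or> e \<inter> A = {}" by simp
        with ab AB show False by auto
      qed
    next
      assume [simp]: "Z = {}"
      have "e \<subseteq> A \<or> e \<inter> A = {}" if "e \<in> X \<union> Y" for e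
        using that XYZ(1,2) AB(1) by (auto simp: pairs_def)
      then show "closed_in (V, X \<union> Y \<union> Z) A" using A by (simp add: closed_in_def)
    qed
    moreover have "(X \<union> Y \<union> {}) \<inter> pairs A = X" "(X \<union> Y \<union> {}) \<inter> pairs B = Y" using XYZ dj by auto
    ultimately show ?thesis by (auto simp: indicator_def)
  qed
  have supp: "X \<subseteq> P" if "X \<in> set_pmf (random_subset P p)" for X P
    using that set_random_subset by blast
  have "(\<integral>\<^sup>+E. (if closed_in (V, E) A then F (E \<inter> pairs A) * H (E \<inter> pairs B) else 0) \<partial>random_subset (pairs V) p)
    = (\<integral>\<^sup>+X. \<integral>\<^sup>+Y. \<integral>\<^sup>+Z. F X * H Y * indicator {{}} Z \<partial>random_subset (cross_pairs A B) p
        \<partial>random_subset (pairs B) p \<partial>random_subset (pairs A) p)"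
    unfolding rs nn_integral_map_pmf case_prod_unfold nn_integral_pair_pmf' fst_conv snd_conv
    by (intro nn_integral_cong_AE AE_pmfI val supp)
  also have "\<dots> = (\<integral>\<^sup>+X. \<integral>\<^sup>+Y. F X * H Y * ennreal ((1 - p) ^ (card A * card B))
        \<partial>random_subset (pairs B) p \<partial>random_subset (pairs A) p)"
    using p fin by (simp add: nn_integral_cmult emeasure_pmf_single pmf_random_subset_empty card_cross_pairs[OF AB(1)])
  also have "\<dots> = ennreal ((1 - p) ^ (card A * card B)) *
      ((\<integral>\<^sup>+E. F E \<partial>random_subset (pairs A) p) * (\<integral>\<^sup>+E. H E \<partial>random_subset (pairs B) p))"
    by (simp add: nn_integral_cmult nn_integral_multc mult_ac)
  finally show ?thesis by (simp only: B_def)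
qed

text \<open>Invariance under relabellings within one vertex type is what allows an integral over
  graphs on \<open>A\<close> to be replaced by one over graphs on
  \<open>{..<card A}\<close>.\<close>

definition iso_invariant :: "('v set \<Rightarrow> 'v set set \<Rightarrow> 'b) \<Rightarrow> bool" where
  "iso_invariant F \<longleftrightarrow> (\<forall>\<sigma> A E. finite A \<longrightarrow> inj_on \<sigma> A \<longrightarrow> E \<subseteq> pairs A \<longrightarrow> F (\<sigma> ` A) ((`) \<sigma> ` E) = F A E)"

lemma nn_integral_iso_invariant:
  fixes F :: "nat set \<Rightarrow> nat set set \<Rightarrow> ennreal"
  assumes "iso_invariant F" "finite A"
  shows "(\<integral>\<^sup>+E. F A E \<partial>random_subset (pairs A) p) = (\<integral>\<^sup>+E. F {..<card A} E \<partial>erdos_renyi_pmf (card A) p)"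
proof -
  obtain \<sigma> where \<sigma>: "bij_betw \<sigma> {..<card A} A"
    using ex_bij_betw_nat_finite[OF assms(2)] by (auto simp: atLeast0LessThan)
  then have inj: "inj_on \<sigma> {..<card A}" and A: "\<sigma> ` {..<card A} = A" by (auto simp: bij_betw_def)
  have "pairs A = (`) \<sigma> ` pairs {..<card A}"
    using pairs_image[OF inj] by (simp add: A)
  then have "random_subset (pairs A) p = map_pmf ((`) ((`) \<sigma>)) (random_subset (pairs {..<card A}) p)"
    using random_subset_image[OF _ inj_on_image_pairs[OF inj], of p] by (simp add: finite_pairs)
  moreover have "F A ((`) \<sigma> ` E) = F {..<card A} E" if "E \<in> set_pmf (random_subset (pairs {..<card A}) p)" for E
    using assms(1)[unfolded iso_invariant_def, rule_format, OF _ inj, of E] that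
      set_random_subset[of "pairs {..<card A}" p] by (auto simp: A)
  ultimately show ?thesis
    by (simp add: erdos_renyi_eq_random_subset nn_integral_map_pmf) (intro nn_integral_cong_AE AE_pmfI, simp)
qed

section \<open>The Poisson random graph\<close>

definition poisson_graph :: "real \<Rightarrow> real \<Rightarrow> (nat \<times> nat set set) pmf" where
  "poisson_graph \<alpha> p = bind_pmf (poisson_pmf \<alpha>) (\<lambda>N. map_pmf (Pair N) (erdos_renyi_pmf N p))"

lemma nn_integral_poisson_graph:
  "(\<integral>\<^sup>+x. \<Phi> x \<partial>poisson_graph \<alpha> p) = (\<integral>\<^sup>+N. \<integral>\<^sup>+E. \<Phi> (N, E) \<partial>erdos_renyi_pmf N p \<partial>poisson_pmf \<alpha>)"
  by (simp add: poisson_graph_def)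

lemma set_poisson_graph: "(N, E) \<in> set_pmf (poisson_graph \<alpha> p) \<Longrightarrow> E \<subseteq> pairs {..<N}"
  using set_random_subset by (auto simp: poisson_graph_def erdos_renyi_eq_random_subset)

lemma nn_integral_poisson:
  assumes "0 < \<alpha>"
  shows "(\<integral>\<^sup>+N. g N \<partial>poisson_pmf \<alpha>) = (\<Sum>N. ennreal (\<alpha> ^ N / fact N * exp (- \<alpha>)) * g N)"
  using assms by (simp add: nn_integral_measure_pmf nn_integral_count_space_nat)

text \<open>All \<open>N choose m\<close> vertex sets of size \<open>m\<close> contribute equally:
  by invariance the two integrals in \<open>nn_integral_closed_in_split\<close> depend only on
  \<open>m\<close> and \<open>N - m\<close>.\<close>

lemma nn_integral_erdos_renyi_closed_in_sum:
  fixes F H :: "nat set \<Rightarrow> nat set set \<Rightarrow> ennreal"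
  assumes p: "0 \<le> p" "p \<le> 1" and F: "iso_invariant F" and H: "iso_invariant H"
  shows "(\<integral>\<^sup>+E. (\<Sum>A | closed_in ({..<N}, E) A \<and> card A = m. F A (E \<inter> pairs A) * H ({..<N} - A) (E \<inter> pairs ({..<N} - A)))
      \<partial>erdos_renyi_pmf N p)
    = of_nat (N choose m) * (ennreal ((1 - p) ^ (m * (N - m))) *
        ((\<integral>\<^sup>+E. F {..<m} E \<partial>erdos_renyi_pmf m p) * (\<integral>\<^sup>+E. H {..<N - m} E \<partial>erdos_renyi_pmf (N - m) p)))"
proof -
  let ?V = "{..<N}"
  have "(\<Sum>A | closed_in (?V, E) A \<and> card A = m. F A (E \<inter> pairs A) * H (?V - A) (E \<inter> pairs (?V - A))) =
     (\<Sum>A | A \<subseteq> ?V \<and> card A = m. if closed_in (?V, E) A then F A (E \<inter> pairs A) * H (?V - A) (E \<inter> pairs (?V - A)) else 0)" for E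
    using closed_in_subset[of "(?V, E)"] by (intro sum.mono_neutral_cong_left) auto
  then have "(\<integral>\<^sup>+E. (\<Sum>A | closed_in (?V, E) A \<and> card A = m. F A (E \<inter> pairs A) * H (?V - A) (E \<inter> pairs (?V - A))) \<partial>erdos_renyi_pmf N p)
    = (\<Sum>A | A \<subseteq> ?V \<and> card A = m. \<integral>\<^sup>+E. (if closed_in (?V, E) A then F A (E \<inter> pairs A) * H (?V - A) (E \<inter> pairs (?V - A)) else 0) \<partial>random_subset (pairs ?V) p)"
    by (simp add: nn_integral_sum erdos_renyi_eq_random_subset)
  also have "\<dots> = (\<Sum>A | A \<subseteq> ?V \<and> card A = m. ennreal ((1 - p) ^ (m * (N - m))) *
        ((\<integral>\<^sup>+E. F {..<m} E \<partial>erdos_renyi_pmf m p) * (\<integral>\<^sup>+E. H {..<N - m} E \<partial>erdos_renyi_pmf (N - m) p)))"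
  proof (intro sum.cong refl)
    fix A assume "A \<in> {A. A \<subseteq> ?V \<and> card A = m}"
    then have A: "A \<subseteq> ?V" and m: "card A = m" by simp_all
    have fin: "finite A" "finite (?V - A)" using A finite_subset by auto
    have c: "card (?V - A) = N - m" using A fin m by (simp add: card_Diff_subset)
    show "(\<integral>\<^sup>+E. (if closed_in (?V, E) A then F A (E \<inter> pairs A) * H (?V - A) (E \<inter> pairs (?V - A)) else 0) \<partial>random_subset (pairs ?V) p)
      = ennreal ((1 - p) ^ (m * (N - m))) *
        ((\<integral>\<^sup>+E. F {..<m} E \<partial>erdos_renyi_pmf m p) * (\<integral>\<^sup>+E. H {..<N - m} E \<partial>erdos_renyi_pmf (N - m) p))"
      unfolding nn_integral_closed_in_split[OF finite_lessThan A p]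
        nn_integral_iso_invariant[OF F fin(1)] nn_integral_iso_invariant[OF H fin(2)] c m ..
  qed
  also have "\<dots> = of_nat (N choose m) * (ennreal ((1 - p) ^ (m * (N - m))) *
        ((\<integral>\<^sup>+E. F {..<m} E \<partial>erdos_renyi_pmf m p) * (\<integral>\<^sup>+E. H {..<N - m} E \<partial>erdos_renyi_pmf (N - m) p)))"
    using n_subsets[of ?V m] by simp
  finally show ?thesis .
qed

text \<open>A formula of Mecke type. With \<open>N = M + m\<close> and \<open>q = 1 - p\<close>, the
  weight \<open>\<alpha> ^ N / fact N * (N choose m) * q ^ (m * M)\<close> is the product of
  \<open>\<alpha> ^ m / fact m\<close> and \<open>(\<alpha> * q ^ m) ^ M / fact M\<close>. So the
  number \<open>M\<close> of vertices outside the chosen set is again Poisson, of intensity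
  \<open>\<alpha> * q ^ m\<close>.\<close>

theorem nn_integral_poisson_graph_closed_in_sum:
  fixes F H :: "nat set \<Rightarrow> nat set set \<Rightarrow> ennreal"
  assumes \<alpha>: "0 < \<alpha>" and p: "0 \<le> p" "p < 1" and F: "iso_invariant F" and H: "iso_invariant H"
  shows "(\<integral>\<^sup>+(N, E). (\<Sum>A | closed_in ({..<N}, E) A \<and> card A = m. F A (E \<inter> pairs A) * H ({..<N} - A) (E \<inter> pairs ({..<N} - A)))
      \<partial>poisson_graph \<alpha> p)
    = ennreal (\<alpha> ^ m / fact m * exp (- \<alpha> * (1 - (1 - p) ^ m))) * (\<integral>\<^sup>+E. F {..<m} E \<partial>erdos_renyi_pmf m p) *
        (\<integral>\<^sup>+(N, E). H {..<N} E \<partial>poisson_graph (\<alpha> * (1 - p) ^ m) p)"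
proof -
  define q where "q = 1 - p"
  have q: "0 < q" "q \<le> 1" using p by (auto simp: q_def)
  define f where "f m = (\<integral>\<^sup>+E. F {..<m} E \<partial>erdos_renyi_pmf m p)" for m
  define h where "h m = (\<integral>\<^sup>+E. H {..<m} E \<partial>erdos_renyi_pmf m p)" for m
  define a where "a = ennreal (\<alpha> ^ m / fact m * exp (- \<alpha> * (1 - q ^ m))) * f m"
  define b where "b M = ennreal ((\<alpha> * q ^ m) ^ M / fact M * exp (- (\<alpha> * q ^ m))) * h M" for M
  define t where "t N = ennreal (\<alpha> ^ N / fact N * exp (- \<alpha>)) * (of_nat (N choose m) * (ennreal (q ^ (m * (N - m))) * (f m * h (N - m))))" for N
  \<comment> \<open>The factor \<open>exp (- \<alpha>)\<close> splits as well, one part normalising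
    the Poisson law of intensity \<open>\<alpha> * q ^ m\<close>. The identity is shown for
    nonnegative reals and then carried over to \<open>ennreal\<close>.\<close>
  have shift: "t (M + m) = a * b M" for M
  proof -
    define A C Q X Y where "A = \<alpha> ^ (M + m) / fact (M + m) * exp (- \<alpha>)" and "C = real ((M + m) choose m)"
      and "Q = q ^ (m * M)" and "X = \<alpha> ^ m / fact m * exp (- \<alpha> * (1 - q ^ m))"
      and "Y = (\<alpha> * q ^ m) ^ M / fact M * exp (- (\<alpha> * q ^ m))"
    have nn: "0 \<le> A" "0 \<le> C" "0 \<le> Q" "0 \<le> X" "0 \<le> Y"
      using \<alpha> q by (simp_all add: A_def C_def Q_def X_def Y_def)
    have "C = fact (M + m) / (fact m * fact M)"
      using binomial_fact[of m "M + m", where 'a = real] by (simp add: C_def)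
    moreover have "exp (- \<alpha>) = exp (- \<alpha> * (1 - q ^ m)) * exp (- (\<alpha> * q ^ m))"
      by (simp add: exp_add[symmetric] algebra_simps)
    ultimately have "A * (C * Q) = X * Y"
      by (simp add: A_def Q_def X_def Y_def power_add power_mult_distrib power_mult)
    then have "ennreal A * (ennreal C * ennreal Q) = ennreal X * ennreal Y"
      using nn by (simp flip: ennreal_mult)
    then have "ennreal A * (ennreal C * ennreal Q) * (f m * h M) = ennreal X * ennreal Y * (f m * h M)"
      by simp
    then show ?thesis
      unfolding t_def a_def b_def add_diff_cancel_right' ennreal_of_nat_eq_real_of_nat
        A_def[symmetric] C_def[symmetric] Q_def[symmetric] X_def[symmetric] Y_def[symmetric]
      by (simp only: mult_ac)
  qed
  have "(\<integral>\<^sup>+(N, E). (\<Sum>A | closed_in ({..<N}, E) A \<and> card A = m. F A (E \<inter> pairs A) * H ({..<N} - A) (E \<inter> pairs ({..<N} - A)))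
      \<partial>poisson_graph \<alpha> p) = (\<Sum>N. t N)"
    unfolding nn_integral_poisson_graph prod.case nn_integral_poisson[OF \<alpha>]
      nn_integral_erdos_renyi_closed_in_sum[OF p(1) less_imp_le[OF p(2)] F H] f_def h_def q_def t_def ..
  also have "\<dots> = (\<Sum>M. t (M + m)) + (\<Sum>N<m. t N)"
    by (rule suminf_offset) simp
  \<comment> \<open>For \<open>N < m\<close> the binomial coefficient vanishes, whatever the
    truncated difference \<open>N - m\<close> contributes.\<close>
  also have "(\<Sum>N<m. t N) = 0" by (simp add: t_def)
  also have "(\<Sum>M. t (M + m)) + 0 = a * (\<Sum>M. b M)" by (simp add: shift)
  also have "\<dots> = a * (\<integral>\<^sup>+(N, E). H {..<N} E \<partial>poisson_graph (\<alpha> * q ^ m) p)"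
    using \<alpha> q by (simp add: nn_integral_poisson_graph nn_integral_poisson b_def h_def)
  finally show ?thesis by (simp only: a_def f_def q_def)
qed

section \<open>Closed sets of large components\<close>

text \<open>This generating function is evaluated at \<open>1 + 1 / K\<close> to bound the number of
  unions of large components, and at \<open>1 - \<delta>\<close> for a lower tail bound.\<close>

lemma nn_integral_poisson_power:
  assumes "0 < \<alpha>" "0 \<le> b"
  shows "(\<integral>\<^sup>+N. ennreal (b ^ N) \<partial>poisson_pmf \<alpha>) = ennreal (exp (\<alpha> * (b - 1)))"
proof -
  have "(\<lambda>N. (\<alpha> * b) ^ N /\<^sub>R fact N * exp (- \<alpha>)) sums (exp (\<alpha> * b) * exp (- \<alpha>))"
    by (intro sums_mult2 exp_converges)
  then have "(\<lambda>N. \<alpha> ^ N / fact N * exp (- \<alpha>) * b ^ N) sums exp (\<alpha> * (b - 1))"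
    by (simp add: exp_add[symmetric] algebra_simps power_mult_distrib divide_inverse)
  then have "(\<Sum>N. ennreal (\<alpha> ^ N / fact N * exp (- \<alpha>) * b ^ N)) = ennreal (exp (\<alpha> * (b - 1)))"
    using assms by (intro suminf_ennreal_eq) simp_all
  then show ?thesis
    unfolding nn_integral_poisson[OF assms(1)] using assms by (simp flip: ennreal_mult)
qed

text \<open>With \<open>H = 1\<close> the last factor in
  \<open>nn_integral_poisson_graph_closed_in_sum\<close> is 1, so the intensity enters only through
  the explicit prefactor. The factor here is the quotient of the prefactors at
  \<open>\<alpha>\<close> and \<open>\<alpha>'\<close>.\<close>

lemma nn_integral_poisson_graph_intensity:
  fixes F :: "nat set \<Rightarrow> nat set set \<Rightarrow> ennreal"
  assumes "0 < \<alpha>" "0 < \<alpha>'" "0 \<le> p" "p < 1" and F: "iso_invariant F"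
  shows "(\<integral>\<^sup>+(N, E). (\<Sum>A | closed_in ({..<N}, E) A \<and> card A = m. F A (E \<inter> pairs A)) \<partial>poisson_graph \<alpha> p)
    = ennreal ((\<alpha> / \<alpha>') ^ m * exp (- (\<alpha> - \<alpha>') * (1 - (1 - p) ^ m))) *
      (\<integral>\<^sup>+(N, E). (\<Sum>A | closed_in ({..<N}, E) A \<and> card A = m. F A (E \<inter> pairs A)) \<partial>poisson_graph \<alpha>' p)"
proof -
  have inv1: "iso_invariant (\<lambda>(A :: nat set) (E :: nat set set). 1 :: ennreal)"
    by (simp add: iso_invariant_def)
  have "(\<alpha> / \<alpha>') ^ m * exp (- (\<alpha> - \<alpha>') * (1 - (1 - p) ^ m)) * (\<alpha>' ^ m / fact m * exp (- \<alpha>' * (1 - (1 - p) ^ m)))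
     = ((\<alpha> / \<alpha>') ^ m * \<alpha>' ^ m) / fact m * (exp (- (\<alpha> - \<alpha>') * (1 - (1 - p) ^ m)) * exp (- \<alpha>' * (1 - (1 - p) ^ m)))"
    by simp
  also have "\<dots> = \<alpha> ^ m / fact m * exp (- \<alpha> * (1 - (1 - p) ^ m))"
    using assms(2) by (simp add: power_mult_distrib[symmetric] exp_add[symmetric] algebra_simps)
  finally have "ennreal (\<alpha> ^ m / fact m * exp (- \<alpha> * (1 - (1 - p) ^ m))) =
      ennreal ((\<alpha> / \<alpha>') ^ m * exp (- (\<alpha> - \<alpha>') * (1 - (1 - p) ^ m))) * ennreal (\<alpha>' ^ m / fact m * exp (- \<alpha>' * (1 - (1 - p) ^ m)))"
    using assms(1,2) by (subst ennreal_mult[symmetric]) simp_all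
  then show ?thesis
    using nn_integral_poisson_graph_closed_in_sum[OF assms(1,3,4) F inv1, of m]
      nn_integral_poisson_graph_closed_in_sum[OF assms(2,3,4) F inv1, of m]
    by (simp add: mult.assoc case_prod_unfold)
qed

section \<open>Unions of large components\<close>

text \<open>For a closed set with its induced edges this means being a union of components of size
  at least \<open>K\<close>; the empty set qualifies.\<close>

definition coarse :: "nat \<Rightarrow> 'v set \<Rightarrow> 'v set set \<Rightarrow> bool" where
  "coarse K A E \<longleftrightarrow> (\<forall>C\<in>components (A, E). K \<le> card C)"

lemma iso_invariant_coarse: "iso_invariant (coarse K :: 'a set \<Rightarrow> _)"
proof -
  have "coarse K (\<sigma> ` A) ((`) \<sigma> ` E) = coarse K A E" if "inj_on \<sigma> A" "E \<subseteq> pairs A" for \<sigma> :: "'a \<Rightarrow> 'a" and A E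
  proof -
    have "E \<subseteq> Pow A" using that(2) by (auto simp: pairs_def)
    from image_card_components_image[OF that(1) this]
    have "(\<forall>k\<in>card ` components (\<sigma> ` A, (`) \<sigma> ` E). K \<le> k) \<longleftrightarrow> (\<forall>k\<in>card ` components (A, E). K \<le> k)" by simp
    then show ?thesis by (simp add: coarse_def)
  qed
  then show ?thesis by (simp add: iso_invariant_def)
qed

lemma coarse_closed_in:
  assumes "E \<subseteq> pairs V" "closed_in (V, E) A"
  shows "coarse K A (E \<inter> pairs A) \<longleftrightarrow> (\<forall>C\<in>components (V, E). C \<subseteq> A \<longrightarrow> K \<le> card C)"
  using components_closed_in[OF assms] by (auto simp: coarse_def)

text \<open>Such a set is determined by the components of size at least \<open>K\<close> inside it,
  and there are at most \<open>card V / K\<close> of those in all. The bound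
  \<open>2 ^ (card V / K)\<close> is weakened to a power with exponent \<open>card V\<close>, whose
  Poisson mean is explicit.\<close>

lemma card_coarse_closed_in_le:
  assumes V: "finite V" and E: "E \<subseteq> pairs V" and K: "0 < K"
  shows "real (card {A. closed_in (V, E) A \<and> coarse K A (E \<inter> pairs A)}) \<le> (1 + 1 / real K) ^ card V"
proof -
  define \<C> where "\<C> = {C \<in> components (V, E). K \<le> card C}"
  have fin: "finite \<C>" using finite_components[of "(V, E)"] V by (simp add: \<C>_def)
  have "inj_on (\<lambda>A. {C \<in> components (V, E). C \<subseteq> A}) {A. closed_in (V, E) A \<and> coarse K A (E \<inter> pairs A)}"
  proof (rule inj_onI)
    fix A B assume "A \<in> {A. closed_in (V, E) A \<and> coarse K A (E \<inter> pairs A)}" "B \<in> {A. closed_in (V, E) A \<and> coarse K A (E \<inter> pairs A)}"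
      and eq: "{C \<in> components (V, E). C \<subseteq> A} = {C \<in> components (V, E). C \<subseteq> B}"
    then have "closed_in (V, E) A" "closed_in (V, E) B" by simp_all
    from this[THEN closed_in_eq_Union] show "A = B" unfolding eq by (rule trans[OF _ sym])
  qed
  moreover have "(\<lambda>A. {C \<in> components (V, E). C \<subseteq> A}) ` {A. closed_in (V, E) A \<and> coarse K A (E \<inter> pairs A)} \<subseteq> Pow \<C>"
    using coarse_closed_in[OF E] by (auto simp: \<C>_def)
  ultimately have "card {A. closed_in (V, E) A \<and> coarse K A (E \<inter> pairs A)} \<le> card (Pow \<C>)"
    using fin by (intro card_inj_on_le) auto
  then have "real (card {A. closed_in (V, E) A \<and> coarse K A (E \<inter> pairs A)}) \<le> 2 ^ card \<C>"
    unfolding card_Pow[OF fin] by (metis of_nat_le_iff of_nat_numeral of_nat_power)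
  also have "2 \<le> (1 + 1 / real K) ^ K"
  proof -
    have "- 1 \<le> 1 / real K" by (rule order_trans[of _ 0]) simp_all
    from Bernoulli_inequality[OF this, of K] K show "(2 :: real) \<le> (1 + 1 / real K) ^ K" by simp
  qed
  then have "(2 :: real) ^ card \<C> \<le> ((1 + 1 / real K) ^ K) ^ card \<C>" by (intro power_mono) simp_all
  also have "\<dots> = (1 + 1 / real K) ^ (K * card \<C>)" by (simp add: power_mult)
  also have "\<dots> \<le> (1 + 1 / real K) ^ card V"
  proof (rule power_increasing)
    have "K * card \<C> = (\<Sum>C\<in>\<C>. K)" by simp
    also have "\<dots> \<le> (\<Sum>C\<in>\<C>. card C)" by (intro sum_mono) (simp add: \<C>_def)
    also have "\<dots> = card (\<Union>\<C>)"
      using V by (intro card_Union_components[symmetric, of "(V, E)"]) (auto simp: \<C>_def)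
    also have "\<dots> \<le> card V"
      using V component_subset[of _ "(V, E)"] by (intro card_mono) (auto simp: \<C>_def)
    finally show "K * card \<C> \<le> card V" .
  qed simp
  finally show ?thesis .
qed

text \<open>The intensity \<open>\<alpha> = m / (1 - (1 - p) ^ m)\<close> maximises
  \<open>\<alpha> ^ m * exp (- \<alpha> * (1 - (1 - p) ^ m))\<close>, so passing from it to
  \<open>n\<close> gains the most: the factor is \<open>x ^ m * exp (- m * (x - 1))\<close>. At
  \<open>\<alpha>\<close> the crude bound \<open>(1 + 1 / K) ^ N\<close> has mean
  \<open>exp (\<alpha> / K)\<close>, the source of the last term in the exponent.\<close>

lemma nn_integral_coarse_closed_in_le:
  assumes n: "0 < n" and p: "0 < p" "p < 1" and K: "0 < K" and m: "0 < m"
  defines "x \<equiv> n * (1 - (1 - p) ^ m) / real m"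
  shows "(\<integral>\<^sup>+(N, E). of_nat (card {A. closed_in ({..<N}, E) A \<and> card A = m \<and> coarse K A (E \<inter> pairs A)}) \<partial>poisson_graph n p)
     \<le> ennreal (exp (- real m * (x - 1 - ln x - 1 / (real K * (1 - (1 - p) ^ m)))))"
proof -
  let ?q = "1 - (1 - p) ^ m"
  have q: "0 < ?q" using p m by (simp add: power_less_one_iff)
  define \<alpha> where "\<alpha> = real m / ?q"
  have \<alpha>: "0 < \<alpha>" using q m by (simp add: \<alpha>_def)
  have x: "0 < x" "n / \<alpha> = x" "(n - \<alpha>) * ?q = m * (x - 1)"
    using q m n by (simp_all add: x_def \<alpha>_def field_simps)
  let ?F = "\<lambda>A E. of_bool (coarse K A E) :: ennreal"
  have inv: "iso_invariant (\<lambda>(A :: nat set) E. ?F A E)"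
    using iso_invariant_coarse[of K] by (auto simp: iso_invariant_def)
  have fin: "finite {A. closed_in ({..<N}, E) A \<and> card A = m}" for N and E :: "nat set set"
    by (intro finite_closed_in) simp
  have count: "(\<Sum>A | closed_in ({..<N}, E) A \<and> card A = m. ?F A (E \<inter> pairs A)) =
      of_nat (card {A. closed_in ({..<N}, E) A \<and> card A = m \<and> coarse K A (E \<inter> pairs A)})" for N and E :: "nat set set"
  proof -
    have "{A. closed_in ({..<N}, E) A \<and> card A = m} \<inter> {A. coarse K A (E \<inter> pairs A)} =
        {A. closed_in ({..<N}, E) A \<and> card A = m \<and> coarse K A (E \<inter> pairs A)}" by auto
    then show ?thesis unfolding of_bool_def sum.If_cases[OF fin] by simp
  qed
  have "(\<integral>\<^sup>+(N, E). of_nat (card {A. closed_in ({..<N}, E) A \<and> card A = m \<and> coarse K A (E \<inter> pairs A)}) \<partial>poisson_graph \<alpha> p)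
    \<le> (\<integral>\<^sup>+(N, E). ennreal ((1 + 1 / real K) ^ N) \<partial>poisson_graph \<alpha> p)"
  proof (intro nn_integral_mono_AE AE_pmfI)
    have "ennreal (of_nat (card {A. closed_in ({..<N}, E) A \<and> card A = m \<and> coarse K A (E \<inter> pairs A)})) \<le> ennreal ((1 + 1 / real K) ^ N)"
      if "E \<subseteq> pairs {..<N}" for N and E :: "nat set set"
    proof (rule ennreal_leI)
      have "card {A. closed_in ({..<N}, E) A \<and> card A = m \<and> coarse K A (E \<inter> pairs A)}
         \<le> card {A. closed_in ({..<N}, E) A \<and> coarse K A (E \<inter> pairs A)}"
        by (intro card_mono finite_closed_in) auto
      then show "real (card {A. closed_in ({..<N}, E) A \<and> card A = m \<and> coarse K A (E \<inter> pairs A)}) \<le> (1 + 1 / real K) ^ N"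
        using card_coarse_closed_in_le[OF _ that K] by simp
    qed
    then show "(case y of (N, E) \<Rightarrow> of_nat (card {A. closed_in ({..<N}, E) A \<and> card A = m \<and> coarse K A (E \<inter> pairs A)}))
       \<le> (case y of (N, E) \<Rightarrow> ennreal ((1 + 1 / real K) ^ N))" if "y \<in> set_pmf (poisson_graph \<alpha> p)" for y
      using that by (cases y) (simp add: ennreal_of_nat_eq_real_of_nat set_poisson_graph)
  qed
  also have "\<dots> = ennreal (exp (\<alpha> / real K))"
    using nn_integral_poisson_power[OF \<alpha>, of "1 + 1 / real K"] by (simp add: nn_integral_poisson_graph)
  finally have le: "(\<integral>\<^sup>+(N, E). of_nat (card {A. closed_in ({..<N}, E) A \<and> card A = m \<and> coarse K A (E \<inter> pairs A)}) \<partial>poisson_graph \<alpha> p)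
    \<le> ennreal (exp (\<alpha> / real K))" .
  have "(n / \<alpha>) ^ m * exp (- (n - \<alpha>) * ?q) * exp (\<alpha> / real K) = exp (real m * ln x) * exp (- (real m * (x - 1))) * exp (\<alpha> / real K)"
    using x by (simp add: exp_of_nat_mult algebra_simps)
  also have "\<dots> = exp (- real m * (x - 1 - ln x - 1 / (real K * ?q)))"
    using q by (simp add: exp_add[symmetric] \<alpha>_def algebra_simps)
  finally have e: "(n / \<alpha>) ^ m * exp (- (n - \<alpha>) * ?q) * exp (\<alpha> / real K) = exp (- real m * (x - 1 - ln x - 1 / (real K * ?q)))" .
  have "(\<integral>\<^sup>+(N, E). of_nat (card {A. closed_in ({..<N}, E) A \<and> card A = m \<and> coarse K A (E \<inter> pairs A)}) \<partial>poisson_graph n p)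
    = ennreal ((n / \<alpha>) ^ m * exp (- (n - \<alpha>) * ?q)) *
      (\<integral>\<^sup>+(N, E). of_nat (card {A. closed_in ({..<N}, E) A \<and> card A = m \<and> coarse K A (E \<inter> pairs A)}) \<partial>poisson_graph \<alpha> p)"
    using nn_integral_poisson_graph_intensity[OF n \<alpha> _ p(2) inv, of m] p(1) unfolding count by simp
  also have "\<dots> \<le> ennreal ((n / \<alpha>) ^ m * exp (- (n - \<alpha>) * ?q)) * ennreal (exp (\<alpha> / real K))"
    by (intro mult_left_mono le) simp
  also have "\<dots> = ennreal (exp (- real m * (x - 1 - ln x - 1 / (real K * ?q))))"
    unfolding e[symmetric] using n \<alpha> by (intro ennreal_mult[symmetric]) simp_all
  finally show ?thesis .
qed

text \<open>Union bound over the bad sizes \<open>m\<close>. By the choice of \<open>K\<close> each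
  contributes at most \<open>exp (- m * \<eta> / 2)\<close>. Half of this exponent gives decay in
  \<open>n\<close>, since \<open>m \<ge> \<epsilon> * n\<close>; the other half gives a geometric
  series in \<open>m\<close>.\<close>

theorem prob_coarse_closed_in_tendsto_0:
  fixes bad :: "nat \<Rightarrow> nat \<Rightarrow> bool"
  assumes c: "0 < c" and \<epsilon>: "0 < \<epsilon>" and \<eta>: "0 < \<eta>" and K: "0 < K" "2 / (\<eta> * (1 - exp (- c * \<epsilon>))) \<le> real K"
    and bad: "\<forall>\<^sub>F n in sequentially. \<forall>m. bad n m \<longrightarrow> \<epsilon> * real n \<le> real m \<and>
      \<eta> \<le> real n * (1 - (1 - c / real n) ^ m) / real m - 1 - ln (real n * (1 - (1 - c / real n) ^ m) / real m)"
  shows "(\<lambda>n. measure (poisson_graph (real n) (c / real n))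
     {(N, E). \<exists>A. closed_in ({..<N}, E) A \<and> bad n (card A) \<and> coarse K A (E \<inter> pairs A)}) \<longlonglongrightarrow> 0"
proof -
  define r where "r = exp (- \<eta> / 4)"
  have r: "0 < r" "r < 1" using \<eta> by (simp_all add: r_def)
  have "(\<lambda>n. exp (- (\<eta> / 4 * \<epsilon>) * real n) * (1 / (1 - r))) \<longlonglongrightarrow> 0 * (1 / (1 - r))"
  proof (intro tendsto_mult tendsto_const)
    have "(\<lambda>n. exp (- (\<eta> / 4 * \<epsilon>)) ^ n) \<longlonglongrightarrow> 0"
      using \<eta> \<epsilon> by (intro LIMSEQ_realpow_zero) simp_all
    then show "(\<lambda>n. exp (- (\<eta> / 4 * \<epsilon>) * real n)) \<longlonglongrightarrow> 0"
      by (simp only: exp_of_nat2_mult)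
  qed
  then have lim: "(\<lambda>n. exp (- (\<eta> / 4 * \<epsilon>) * real n) * (1 / (1 - r))) \<longlonglongrightarrow> 0" by simp
  have "\<forall>\<^sub>F n in sequentially. c < real n"
    using filterlim_real_sequentially by (simp add: filterlim_at_top_dense)
  with bad have "\<forall>\<^sub>F n in sequentially. measure (poisson_graph (real n) (c / real n))
     {(N, E). \<exists>A. closed_in ({..<N}, E) A \<and> bad n (card A) \<and> coarse K A (E \<inter> pairs A)}
     \<le> exp (- (\<eta> / 4 * \<epsilon>) * real n) * (1 / (1 - r))"
  proof eventually_elim
    case (elim n)
    then have n: "0 < real n" using c by simp
    let ?p = "c / real n"
    have p: "0 < ?p" "?p < 1" using c elim n by simp_all
    let ?M = "measure_pmf (poisson_graph (real n) ?p)"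
    let ?X = "\<lambda>m (N, E :: nat set set). {A. closed_in ({..<N}, E) A \<and> card A = m \<and> coarse K A (E \<inter> pairs A)}"
    define S where "S m = {y. bad n m \<and> ?X m y \<noteq> {}}" for m
    have S: "emeasure ?M (S m) \<le> ennreal (exp (- (\<eta> / 4 * \<epsilon>) * real n) * r ^ m)" for m
    proof (cases "bad n m")
      case True
      with elim have m: "\<epsilon> * real n \<le> real m"
        and h: "\<eta> \<le> real n * (1 - (1 - ?p) ^ m) / real m - 1 - ln (real n * (1 - (1 - ?p) ^ m) / real m)"
        by auto
      have "0 < \<epsilon> * real n" using \<epsilon> n by simp
      with m have m0: "0 < m" by (cases m) auto
      \<comment> \<open>This leads to a lower bound on \<open>1 - (1 - ?p) ^ m\<close> that is
        uniform over bad \<open>m\<close>. The threshold for \<open>K\<close> is stated through it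
        and makes the correction term at most \<open>\<eta> / 2\<close>.\<close>
      have "(1 - ?p) ^ m \<le> exp (- ?p) ^ m"
        using p exp_ge_add_one_self[of "- ?p"] by (intro power_mono) simp_all
      also have "\<dots> = exp (- ?p * real m)" by (simp only: exp_of_nat2_mult)
      also have "\<dots> \<le> exp (- c * \<epsilon>)"
        using m c n by (simp add: field_simps mult_left_mono)
      finally have q: "1 - exp (- c * \<epsilon>) \<le> 1 - (1 - ?p) ^ m" by simp
      have q0: "0 < 1 - exp (- c * \<epsilon>)" using c \<epsilon> by simp
      with q have q1: "0 < 1 - (1 - ?p) ^ m" by linarith
      have "1 / (real K * (1 - (1 - ?p) ^ m)) \<le> 1 / (real K * (1 - exp (- c * \<epsilon>)))"
        using q q0 q1 K(1) by (intro divide_left_mono mult_left_mono mult_pos_pos) simp_all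
      also have "\<dots> \<le> \<eta> / 2"
        using K q0 \<eta> by (simp add: field_simps)
      finally have K': "1 / (real K * (1 - (1 - ?p) ^ m)) \<le> \<eta> / 2" .
      define Z where "Z = real n * (1 - (1 - ?p) ^ m) / real m - 1 - ln (real n * (1 - (1 - ?p) ^ m) / real m)
          - 1 / (real K * (1 - (1 - ?p) ^ m))"
      have "\<eta> / 2 \<le> Z" unfolding Z_def using h K' by linarith
      then have "real m * (\<eta> / 2) \<le> real m * Z" by (intro mult_left_mono) simp_all
      moreover have "\<eta> / 4 * (\<epsilon> * real n) \<le> \<eta> / 4 * real m"
        using m \<eta> by (intro mult_left_mono) simp_all
      ultimately have expo: "- real m * Z \<le> - (\<eta> / 4 * \<epsilon>) * real n + real m * (- \<eta> / 4)"
        by (simp add: algebra_simps)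
      have "emeasure ?M (S m) = (\<integral>\<^sup>+y. indicator (S m) y \<partial>?M)" by simp
      \<comment> \<open>First moment bound: a nonempty finite family has at least one
        member.\<close>
      also have "\<dots> \<le> (\<integral>\<^sup>+y. of_nat (card (?X m y)) \<partial>?M)"
      proof (rule nn_integral_mono)
        fix y :: "nat \<times> nat set set"
        obtain N E where y: "y = (N, E)" by (cases y)
        have "finite (?X m y)"
          unfolding y prod.case by (intro finite_closed_in) simp
        then have "y \<in> S m \<Longrightarrow> 1 \<le> card (?X m y)" by (auto simp: S_def Suc_le_eq card_gt_0_iff)
        then show "indicator (S m) y \<le> (of_nat (card (?X m y)) :: ennreal)"
          using of_nat_mono[of 1 "card (?X m y)", where 'a = ennreal] by (simp add: indicator_def)
      qed
      also have "\<dots> \<le> ennreal (exp (- (\<eta> / 4 * \<epsilon>) * real n + real m * (- \<eta> / 4)))"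
        using nn_integral_coarse_closed_in_le[OF n p K(1) m0, folded Z_def] expo
        by (auto simp: case_prod_unfold intro: order_trans ennreal_leI)
      also have "\<dots> = ennreal (exp (- (\<eta> / 4 * \<epsilon>) * real n) * r ^ m)"
        by (simp only: exp_add exp_of_nat_mult r_def)
      finally show ?thesis .
    qed (simp add: S_def)
    have "emeasure ?M {(N, E). \<exists>A. closed_in ({..<N}, E) A \<and> bad n (card A) \<and> coarse K A (E \<inter> pairs A)} = emeasure ?M (\<Union>m. S m)"
      by (intro arg_cong[where f = "emeasure ?M"]) (auto simp: S_def)
    also have "\<dots> \<le> (\<Sum>m. emeasure ?M (S m))"
      by (intro emeasure_subadditive_countably) auto
    also have "\<dots> \<le> (\<Sum>m. ennreal (exp (- (\<eta> / 4 * \<epsilon>) * real n) * r ^ m))"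
      by (intro suminf_le S) simp_all
    also have "\<dots> = ennreal (exp (- (\<eta> / 4 * \<epsilon>) * real n) * (1 / (1 - r)))"
      using r by (intro suminf_ennreal_eq sums_mult geometric_sums) simp_all
    finally show ?case
      using r by (simp add: measure_pmf.emeasure_eq_measure)
  qed
  then show ?thesis
    by (intro tendsto_sandwich[OF _ _ tendsto_const lim]) simp_all
qed

section \<open>The mass of small components\<close>

definition small_mass :: "nat \<Rightarrow> 'v set \<Rightarrow> 'v set set \<Rightarrow> nat" where
  "small_mass K A E = (\<Sum>C | C \<in> components (A, E) \<and> card C < K. card C)"

text \<open>The empty vertex set has no component and so does not count as connected.\<close>

definition connected_on :: "'v set \<Rightarrow> 'v set set \<Rightarrow> bool" where
  "connected_on A E \<longleftrightarrow> card (components (A, E)) = 1"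

lemma inj_on_image_components: "inj_on \<sigma> A \<Longrightarrow> inj_on ((`) \<sigma>) (components (A, E))"
  using component_subset[of _ "(A, E)"] by (auto simp: inj_on_def[of "(`) \<sigma>"] inj_on_image_eq_iff)

lemma iso_invariant_connected_on: "iso_invariant (connected_on :: 'a set \<Rightarrow> _)"
proof -
  have "connected_on (\<sigma> ` A) ((`) \<sigma> ` E) = connected_on A E" if "inj_on \<sigma> A" "E \<subseteq> pairs A" for \<sigma> :: "'a \<Rightarrow> 'a" and A E
  proof -
    have "E \<subseteq> Pow A" using that(2) by (auto simp: pairs_def)
    then show ?thesis
      by (simp add: connected_on_def components_image[OF that(1)] card_image inj_on_image_components[OF that(1)])
  qed
  then show ?thesis by (simp add: iso_invariant_def)
qed

lemma iso_invariant_small_mass: "iso_invariant (small_mass K :: 'a set \<Rightarrow> _)"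
proof -
  have "small_mass K (\<sigma> ` A) ((`) \<sigma> ` E) = small_mass K A E" if \<sigma>: "inj_on \<sigma> A" and E: "E \<subseteq> pairs A" for \<sigma> :: "'a \<Rightarrow> 'a" and A E
  proof -
    have "E \<subseteq> Pow A" using E by (auto simp: pairs_def)
    note comps = components_image[OF \<sigma> this]
    have card: "card (\<sigma> ` C) = card C" if "C \<in> components (A, E)" for C
      using component_subset[OF that] \<sigma> by (intro card_image) (auto intro: inj_on_subset)
    have inj: "inj_on ((`) \<sigma>) {C. C \<in> components (A, E) \<and> card C < K}"
      using inj_on_image_components[OF \<sigma>] by (rule inj_on_subset) auto
    have "{C. C \<in> components (\<sigma> ` A, (`) \<sigma> ` E) \<and> card C < K} = (`) \<sigma> ` {C. C \<in> components (A, E) \<and> card C < K}"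
      unfolding comps using card by (auto simp: image_iff)
    then show ?thesis
      using card by (simp add: small_mass_def sum.reindex[OF inj])
  qed
  then show ?thesis by (simp add: iso_invariant_def)
qed

text \<open>A closed set is the union of the components inside it, so it is itself a component if
  there is exactly one. In this form components fall under the formula for closed sets.\<close>

lemma connected_closed_in_eq:
  assumes E: "E \<subseteq> pairs V"
  shows "closed_in (V, E) A \<and> connected_on A (E \<inter> pairs A) \<longleftrightarrow> A \<in> components (V, E)"
proof
  assume A: "closed_in (V, E) A \<and> connected_on A (E \<inter> pairs A)"
  then obtain C where "{C \<in> components (V, E). C \<subseteq> A} = {C}"
    using components_closed_in[OF E, of A] by (auto simp: connected_on_def card_1_singleton_iff)
  moreover from this have "A = C" using closed_in_eq_Union[of "(V, E)" A] A by simp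
  ultimately show "A \<in> components (V, E)" by auto
next
  assume A: "A \<in> components (V, E)"
  have cl: "closed_in (V, E) A" using closed_in_component[of "(V, E)"] E A by simp
  have "{C \<in> components (V, E). C \<subseteq> A} = {A}"
  proof
    show "{C \<in> components (V, E). C \<subseteq> A} \<subseteq> {A}"
      using components_disjoint[OF A] component_nonempty[of _ "(V, E)"] by fastforce
  qed (use A in auto)
  then show "closed_in (V, E) A \<and> connected_on A (E \<inter> pairs A)"
    using cl components_closed_in[OF E cl] by (simp add: connected_on_def)
qed

text \<open>The formula for closed sets works at a fixed size, hence the grouping by size.\<close>

lemma small_mass_eq_sum:
  assumes "finite V"
  shows "small_mass K V E = (\<Sum>k<K. \<Sum>C | C \<in> components (V, E) \<and> card C = k. k)"
proof -
  have "small_mass K V E = (\<Sum>k<K. \<Sum>C\<in>{C. C \<in> {C. C \<in> components (V, E) \<and> card C < K} \<and> card C = k}. card C)"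
    unfolding small_mass_def using finite_components[of "(V, E)"] assms by (intro sum.group[symmetric]) auto
  also have "\<dots> = (\<Sum>k<K. \<Sum>C | C \<in> components (V, E) \<and> card C = k. k)"
    by (intro sum.cong) auto
  finally show ?thesis .
qed

lemma small_mass_le:
  assumes "finite V"
  shows "small_mass K V E \<le> card V"
proof -
  have "small_mass K V E = card (\<Union>{C. C \<in> components (V, E) \<and> card C < K})"
    unfolding small_mass_def using assms by (intro card_Union_components[symmetric, of "(V, E)"]) auto
  also have "\<dots> \<le> card V"
    using assms component_subset[of _ "(V, E)"] by (intro card_mono) auto
  finally show ?thesis .
qed

text \<open>The complement of a component is closed, so its induced graph has exactly the remaining
  components. The second moment uses this to separate one small component from the rest.\<close>

lemma small_mass_Diff_component:
  assumes V: "finite V" and E: "E \<subseteq> pairs V" and A: "A \<in> components (V, E)" "card A < K"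
  shows "small_mass K V E = card A + small_mass K (V - A) (E \<inter> pairs (V - A))"
proof -
  have cl: "closed_in (V, E) (V - A)"
    using closed_in_Diff[of "(V, E)"] closed_in_component[of "(V, E)"] E A by simp
  have "components (V - A, E \<inter> pairs (V - A)) = components (V, E) - {A}"
  proof -
    have "C \<subseteq> V - A \<longleftrightarrow> C \<noteq> A" if "C \<in> components (V, E)" for C
      using components_disjoint[OF that A(1)] component_subset[OF that] component_nonempty[OF that] by auto
    then show ?thesis using components_closed_in[OF E cl] by auto
  qed
  then have "{C. C \<in> components (V, E) \<and> card C < K} = insert A {C. C \<in> components (V - A, E \<inter> pairs (V - A)) \<and> card C < K}"
    "A \<notin> {C. C \<in> components (V - A, E \<inter> pairs (V - A)) \<and> card C < K}"
    using A by auto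
  then show ?thesis
    unfolding small_mass_def using finite_components[of "(V - A, E \<inter> pairs (V - A))"] V by simp
qed

section \<open>First and second moments of the small mass\<close>

definition component_count :: "nat \<Rightarrow> nat set \<Rightarrow> nat set set \<Rightarrow> ennreal" where
  "component_count k V E = of_nat (card {C. C \<in> components (V, E) \<and> card C = k})"

definition mean_count :: "real \<Rightarrow> nat \<Rightarrow> real \<Rightarrow> ennreal" where
  "mean_count p k \<alpha> = (\<integral>\<^sup>+(N, E). component_count k {..<N} E \<partial>poisson_graph \<alpha> p)"

definition mean_small :: "real \<Rightarrow> nat \<Rightarrow> real \<Rightarrow> ennreal" where
  "mean_small p K \<alpha> = (\<integral>\<^sup>+(N, E). of_nat (small_mass K {..<N} E) \<partial>poisson_graph \<alpha> p)"

lemma sum_connected_closed_in: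
  assumes "finite V" "E \<subseteq> pairs V"
  shows "(\<Sum>A | closed_in (V, E) A \<and> card A = k. of_bool (connected_on A (E \<inter> pairs A)) * g A)
    = (\<Sum>C | C \<in> components (V, E) \<and> card C = k. g C :: ennreal)"
  using connected_closed_in_eq[OF assms(2)] finite_closed_in[of "(V, E)"] assms(1)
  by (intro sum.mono_neutral_cong_right) auto

lemma mean_small_eq: "mean_small p K \<alpha> = (\<Sum>k<K. of_nat k * mean_count p k \<alpha>)"
proof -
  have "(case x of (N, E) \<Rightarrow> of_nat (small_mass K {..<N} E)) =
     (\<Sum>k<K. of_nat k * (case x of (N, E) \<Rightarrow> component_count k {..<N} E))" for x :: "nat \<times> nat set set"
    by (cases x) (simp add: small_mass_eq_sum component_count_def mult.commute)
  then have "mean_small p K \<alpha> = (\<integral>\<^sup>+x. (\<Sum>k<K. of_nat k * (case x of (N, E) \<Rightarrow> component_count k {..<N} E)) \<partial>poisson_graph \<alpha> p)"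
    unfolding mean_small_def by (intro nn_integral_cong)
  then show ?thesis by (simp add: mean_count_def nn_integral_sum nn_integral_cmult)
qed

text \<open>Small components cover at most all \<open>N\<close> vertices, and the Poisson law has
  mean \<open>\<alpha>\<close>.\<close>

lemma mean_small_le:
  assumes "0 < \<alpha>"
  shows "mean_small p K \<alpha> \<le> ennreal \<alpha>"
proof -
  have "mean_small p K \<alpha> \<le> (\<integral>\<^sup>+(N, E). of_nat N \<partial>poisson_graph \<alpha> p)"
    unfolding mean_small_def using small_mass_le[OF finite_lessThan, of K]
    by (intro nn_integral_mono) (auto intro: of_nat_mono)
  also have "\<dots> = (\<integral>\<^sup>+N. of_nat N \<partial>poisson_pmf \<alpha>)"
    by (simp add: nn_integral_poisson_graph)
  also have "\<dots> = (\<Sum>N. ennreal (\<alpha> ^ N / fact N * exp (- \<alpha>)) * of_nat N)"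
    by (rule nn_integral_poisson[OF assms])
  \<comment> \<open>The index is shifted by one: the term \<open>N = 0\<close> vanishes, and in the
    others the factor \<open>N\<close> cancels against the factorial.\<close>
  also have "\<dots> = (\<Sum>N. ennreal (\<alpha> ^ (N + 1) / fact (N + 1) * exp (- \<alpha>)) * of_nat (N + 1))
      + (\<Sum>N<1. ennreal (\<alpha> ^ N / fact N * exp (- \<alpha>)) * of_nat N)"
    by (rule suminf_offset) simp
  also have "\<dots> = (\<Sum>N. ennreal \<alpha> * (ennreal (\<alpha> ^ N / fact N * exp (- \<alpha>)) * 1))"
  proof -
    have "ennreal (\<alpha> ^ (N + 1) / fact (N + 1) * exp (- \<alpha>)) * of_nat (N + 1) = ennreal \<alpha> * (ennreal (\<alpha> ^ N / fact N * exp (- \<alpha>)) * 1)" for N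
    proof -
      have "\<alpha> ^ (N + 1) / fact (N + 1) * exp (- \<alpha>) * real (N + 1) = \<alpha> * (\<alpha> ^ N / fact N * exp (- \<alpha>))"
        by (simp add: fact_Suc field_simps del: of_nat_Suc)
      then show ?thesis
        unfolding ennreal_of_nat_eq_real_of_nat mult_1_right using assms
        by (subst (1 2) ennreal_mult[symmetric]) simp_all
    qed
    then show ?thesis by simp
  qed
  also have "\<dots> = ennreal \<alpha> * (\<integral>\<^sup>+N. 1 \<partial>poisson_pmf \<alpha>)"
    unfolding nn_integral_poisson[OF assms] by (rule ennreal_suminf_cmult)
  finally show ?thesis by simp
qed

lemma iso_invariant_comp:
  assumes "iso_invariant P"
  shows "iso_invariant (\<lambda>A E. g (P A E))"
  using assms by (auto simp: iso_invariant_def)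

text \<open>The formula for closed sets is applied with \<open>F\<close> the indicator of
  connectedness; outside a component of size \<open>k\<close> it leaves a Poisson graph of intensity
  \<open>\<alpha> * (1 - p) ^ k\<close>. The case \<open>H = 1\<close> identifies the remaining
  factor as \<open>mean_count\<close>.\<close>

lemma nn_integral_component_sum:
  assumes "0 < \<alpha>" "0 \<le> p" "p < 1" and H: "iso_invariant H"
  shows "(\<integral>\<^sup>+(N, E). (\<Sum>C | C \<in> components ({..<N}, E) \<and> card C = k. H ({..<N} - C) (E \<inter> pairs ({..<N} - C))) \<partial>poisson_graph \<alpha> p)
    = mean_count p k \<alpha> * (\<integral>\<^sup>+(N, E). H {..<N} E \<partial>poisson_graph (\<alpha> * (1 - p) ^ k) p)"
proof -
  define F :: "nat set \<Rightarrow> nat set set \<Rightarrow> ennreal" where "F A E = of_bool (connected_on A E)" for A E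
  have F: "iso_invariant F"
    unfolding F_def using iso_invariant_connected_on by (rule iso_invariant_comp)
  have one: "iso_invariant (\<lambda>(A :: nat set) (E :: nat set set). 1 :: ennreal)"
    by (simp add: iso_invariant_def)
  have *: "(\<integral>\<^sup>+(N, E). (\<Sum>C | C \<in> components ({..<N}, E) \<and> card C = k. G ({..<N} - C) (E \<inter> pairs ({..<N} - C))) \<partial>poisson_graph \<alpha> p)
    = ennreal (\<alpha> ^ k / fact k * exp (- \<alpha> * (1 - (1 - p) ^ k))) * (\<integral>\<^sup>+E. F {..<k} E \<partial>erdos_renyi_pmf k p) *
      (\<integral>\<^sup>+(N, E). G {..<N} E \<partial>poisson_graph (\<alpha> * (1 - p) ^ k) p)" if G: "iso_invariant G" for G
    unfolding nn_integral_poisson_graph_closed_in_sum[OF assms(1-3) F G, symmetric]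
  proof (intro nn_integral_cong_AE AE_pmfI)
    fix y assume "y \<in> set_pmf (poisson_graph \<alpha> p)"
    then obtain N E where "y = (N, E)" "E \<subseteq> pairs {..<N}" by (cases y) (auto dest: set_poisson_graph)
    then show "(case y of (N, E) \<Rightarrow> \<Sum>C | C \<in> components ({..<N}, E) \<and> card C = k. G ({..<N} - C) (E \<inter> pairs ({..<N} - C))) =
      (case y of (N, E) \<Rightarrow> \<Sum>A | closed_in ({..<N}, E) A \<and> card A = k. F A (E \<inter> pairs A) * G ({..<N} - A) (E \<inter> pairs ({..<N} - A)))"
      by (simp add: F_def sum_connected_closed_in)
  qed
  have "mean_count p k \<alpha> = (\<integral>\<^sup>+(N, E). (\<Sum>C | C \<in> components ({..<N}, E) \<and> card C = k. 1) \<partial>poisson_graph \<alpha> p)"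
    by (simp add: mean_count_def component_count_def)
  also have "\<dots> = ennreal (\<alpha> ^ k / fact k * exp (- \<alpha> * (1 - (1 - p) ^ k))) * (\<integral>\<^sup>+E. F {..<k} E \<partial>erdos_renyi_pmf k p)"
    using *[OF one] by (simp add: case_prod_unfold)
  finally show ?thesis using *[OF H] by simp
qed

lemma mean_count_intensity:
  assumes "0 < \<alpha>" "0 < \<alpha>'" "0 \<le> p" "p < 1"
  shows "mean_count p k \<alpha> = ennreal ((\<alpha> / \<alpha>') ^ k * exp (- (\<alpha> - \<alpha>') * (1 - (1 - p) ^ k))) * mean_count p k \<alpha>'"
proof -
  define F :: "nat set \<Rightarrow> nat set set \<Rightarrow> ennreal" where "F A E = of_bool (connected_on A E)" for A E
  have F: "iso_invariant F"
    unfolding F_def using iso_invariant_connected_on by (rule iso_invariant_comp)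
  have "mean_count p k \<alpha> = (\<integral>\<^sup>+(N, E). (\<Sum>A | closed_in ({..<N}, E) A \<and> card A = k. F A (E \<inter> pairs A)) \<partial>poisson_graph \<alpha> p)" for \<alpha>
    unfolding mean_count_def
  proof (intro nn_integral_cong_AE AE_pmfI)
    fix y assume "y \<in> set_pmf (poisson_graph \<alpha> p)"
    then obtain N E where y: "y = (N, E)" "E \<subseteq> pairs {..<N}" by (cases y) (auto dest: set_poisson_graph)
    show "(case y of (N, E) \<Rightarrow> component_count k {..<N} E) =
      (case y of (N, E) \<Rightarrow> \<Sum>A | closed_in ({..<N}, E) A \<and> card A = k. F A (E \<inter> pairs A))"
      using sum_connected_closed_in[OF finite_lessThan y(2), where k = k and g = "\<lambda>_. 1"] by (simp add: y F_def component_count_def)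
  qed
  then show ?thesis
    using nn_integral_poisson_graph_intensity[OF assms F, of k] by simp
qed

lemma exp_minus_le_quadratic:
  fixes x :: real
  assumes "0 \<le> x"
  shows "exp (- x) \<le> 1 - x + x\<^sup>2"
proof -
  have "exp (- x) \<le> 1 / (1 + x)"
    using assms exp_ge_add_one_self[of x] by (simp add: exp_minus divide_simps)
  also have "\<dots> \<le> 1 - x + x\<^sup>2"
  proof -
    have "(1 - x + x\<^sup>2) * (1 + x) = 1 + x ^ 3" by (simp add: algebra_simps power2_eq_square power3_eq_cube)
    then show ?thesis using assms by (simp add: divide_simps)
  qed
  finally show ?thesis .
qed

text \<open>For \<open>p = c / n\<close> and bounded \<open>k\<close> the quadratic error stays
  negligible even after multiplication by an intensity of order \<open>n\<close>.\<close>

lemma one_minus_power_bounds: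
  fixes p :: real
  assumes "0 \<le> p" "p \<le> 1"
  shows "1 - (1 - p) ^ k \<le> real k * p" "real k * p - (real k * p)\<^sup>2 \<le> 1 - (1 - p) ^ k"
proof -
  show "1 - (1 - p) ^ k \<le> real k * p"
    using Bernoulli_inequality[of "- p" k] assms by simp
  define x where "x = real k * p"
  have x: "0 \<le> x" using assms by (simp add: x_def)
  have "(1 - p) ^ k \<le> exp (- p) ^ k"
    using assms exp_ge_add_one_self[of "- p"] by (intro power_mono) simp_all
  also have "\<dots> = exp (- x)" by (simp only: x_def exp_of_nat_mult[symmetric]) simp
  also have "\<dots> \<le> 1 - x + x\<^sup>2" by (rule exp_minus_le_quadratic[OF x])
  finally show "real k * p - (real k * p)\<^sup>2 \<le> 1 - (1 - p) ^ k" by (simp add: x_def)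
qed

text \<open>Lowering the intensity multiplies the mean count at size \<open>l\<close> by a power of
  a number at most 1 and by the exponential of
  \<open>n * ((1 - (1 - p) ^ k) * (1 - (1 - p) ^ l))\<close>, where both inner factors are at most
  \<open>K * p\<close>. For \<open>p = c / n\<close> the resulting bound tends to 1.\<close>

lemma mean_small_thinned_le:
  assumes n: "0 < n" and p: "0 \<le> p" "p < 1" and k: "k \<le> K"
  shows "mean_small p K (n * (1 - p) ^ k) \<le> ennreal (exp (n * (real K * p)\<^sup>2)) * mean_small p K n"
proof -
  have q: "0 < (1 - p) ^ k" "(1 - p) ^ k \<le> 1" using p by (auto intro: power_le_one)
  have "mean_count p l (n * (1 - p) ^ k) \<le> ennreal (exp (n * (real K * p)\<^sup>2)) * mean_count p l n" if l: "l \<le> K" for l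
  proof -
    have q1: "0 \<le> 1 - (1 - p) ^ l" using p by (simp add: power_le_one)
    have "1 - (1 - p) ^ j \<le> real K * p" if "j \<le> K" for j
      using one_minus_power_bounds(1)[of p j] p that by (smt (verit) mult_right_mono of_nat_le_iff)
    then have "(1 - (1 - p) ^ k) * (1 - (1 - p) ^ l) \<le> (real K * p) * (real K * p)"
      using k l q q1 p by (intro mult_mono) auto
    then have "n * ((1 - (1 - p) ^ k) * (1 - (1 - p) ^ l)) \<le> n * (real K * p)\<^sup>2"
      using n by (simp add: power2_eq_square)
    moreover have "- (n * (1 - p) ^ k - n) * (1 - (1 - p) ^ l) = n * ((1 - (1 - p) ^ k) * (1 - (1 - p) ^ l))"
      by (simp add: algebra_simps)
    moreover have "(n * (1 - p) ^ k / n) ^ l \<le> 1" using n q by (intro power_le_one) auto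
    ultimately have "(n * (1 - p) ^ k / n) ^ l * exp (- (n * (1 - p) ^ k - n) * (1 - (1 - p) ^ l)) \<le> 1 * exp (n * (real K * p)\<^sup>2)"
      using n q by (intro mult_mono) auto
    then show ?thesis
      using mean_count_intensity[of "n * (1 - p) ^ k" n p l] n p q by (simp add: mult_right_mono ennreal_leI)
  qed
  then show ?thesis
    unfolding mean_small_eq sum_distrib_left
    by (intro sum_mono) (simp add: mult.left_commute mult_left_mono)
qed

text \<open>The square is a sum over small components \<open>C\<close> of \<open>card C\<close>
  times the total small mass, and this total is \<open>card C\<close> plus the small mass outside
  \<open>C\<close>. The outside is a Poisson graph of slightly lower intensity, so its mean is
  controlled by \<open>mean_small_thinned_le\<close>.\<close>

lemma second_moment_small_mass:
  assumes n: "0 < n" and p: "0 \<le> p" "p < 1"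
  shows "(\<integral>\<^sup>+(N, E). of_nat ((small_mass K {..<N} E)\<^sup>2) \<partial>poisson_graph n p)
    \<le> of_nat K * mean_small p K n + ennreal (exp (n * (real K * p)\<^sup>2)) * (mean_small p K n)\<^sup>2"
proof -
  \<comment> \<open>Evaluated outside a component of size below \<open>K\<close>, \<open>H\<close>
    bounds the small mass of the whole graph.\<close>
  define H :: "nat set \<Rightarrow> nat set set \<Rightarrow> ennreal" where "H A E = of_nat (K + small_mass K A E)" for A E
  have H: "iso_invariant H"
    unfolding H_def using iso_invariant_small_mass by (rule iso_invariant_comp)
  have "of_nat ((small_mass K V E)\<^sup>2) \<le> (\<Sum>k<K. of_nat k * (\<Sum>C | C \<in> components (V, E) \<and> card C = k. H (V - C) (E \<inter> pairs (V - C))))"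
    if V: "finite V" and E: "E \<subseteq> pairs V" for V :: "nat set" and E
  proof -
    have "(small_mass K V E)\<^sup>2 = (\<Sum>k<K. \<Sum>C | C \<in> components (V, E) \<and> card C = k. k * small_mass K V E)"
      unfolding power2_eq_square by (subst small_mass_eq_sum[OF V]) (simp only: sum_distrib_right)
    also have "\<dots> \<le> (\<Sum>k<K. \<Sum>C | C \<in> components (V, E) \<and> card C = k. k * (K + small_mass K (V - C) (E \<inter> pairs (V - C))))"
      using small_mass_Diff_component[OF V E] by (intro sum_mono mult_left_mono) auto
    also have "\<dots> = (\<Sum>k<K. k * (\<Sum>C | C \<in> components (V, E) \<and> card C = k. K + small_mass K (V - C) (E \<inter> pairs (V - C))))"
      by (simp only: sum_distrib_left)
    finally have "of_nat ((small_mass K V E)\<^sup>2) \<le> (of_nat \<dots> :: ennreal)" by (rule of_nat_mono)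
    then show ?thesis by (simp only: of_nat_sum of_nat_mult H_def)
  qed
  then have "(\<integral>\<^sup>+(N, E). of_nat ((small_mass K {..<N} E)\<^sup>2) \<partial>poisson_graph n p)
    \<le> (\<integral>\<^sup>+x. (\<Sum>k<K. of_nat k * (case x of (N, E) \<Rightarrow> \<Sum>C | C \<in> components ({..<N}, E) \<and> card C = k. H ({..<N} - C) (E \<inter> pairs ({..<N} - C)))) \<partial>poisson_graph n p)"
    by (intro nn_integral_mono_AE AE_pmfI) (auto dest: set_poisson_graph)
  also have "\<dots> = (\<Sum>k<K. of_nat k * (mean_count p k n * (\<integral>\<^sup>+(N, E). H {..<N} E \<partial>poisson_graph (n * (1 - p) ^ k) p)))"
    using nn_integral_component_sum[OF n p H] by (simp add: nn_integral_sum nn_integral_cmult)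
  also have "\<dots> = (\<Sum>k<K. of_nat k * (mean_count p k n * (of_nat K + mean_small p K (n * (1 - p) ^ k))))"
    by (simp add: H_def mean_small_def case_prod_unfold nn_integral_add)
  also have "\<dots> \<le> (\<Sum>k<K. of_nat k * (mean_count p k n * (of_nat K + ennreal (exp (n * (real K * p)\<^sup>2)) * mean_small p K n)))"
    using mean_small_thinned_le[OF n p] by (intro sum_mono mult_left_mono add_left_mono) auto
  also have "\<dots> = mean_small p K n * (of_nat K + ennreal (exp (n * (real K * p)\<^sup>2)) * mean_small p K n)"
    unfolding mean_small_eq[of p K n] by (simp only: sum_distrib_right mult.assoc)
  finally show ?thesis by (simp add: distrib_left power2_eq_square mult_ac)
qed

text \<open>At the dual intensity \<open>\<alpha> = (1 - \<beta>) * n\<close> one has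
  \<open>n / \<alpha> = exp (n * p * \<beta>)\<close>. Hence in the change of intensity
  \<open>(n / \<alpha>) ^ k\<close> cancels \<open>exp (- (n - \<alpha>) * k * p)\<close>, the
  first-order part of the other factor, and only the quadratic error of
  \<open>1 - (1 - p) ^ k\<close> survives. At \<open>\<alpha>\<close> the bound
  \<open>mean_small_le\<close> suffices.\<close>

lemma mean_small_dual_le:
  assumes n: "0 < n" and p: "0 \<le> p" "p < 1" and \<beta>: "0 < \<beta>" "\<beta> < 1" and dual: "exp (- (n * p * \<beta>)) = 1 - \<beta>"
  shows "mean_small p K n \<le> ennreal (exp (n * (real K * p)\<^sup>2) * ((1 - \<beta>) * n))"
proof -
  define \<alpha> where "\<alpha> = (1 - \<beta>) * n"
  have \<alpha>: "0 < \<alpha>" "n / \<alpha> = exp (n * p * \<beta>)"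
    using n \<beta> by (simp_all add: \<alpha>_def dual[symmetric] exp_minus field_simps)
  have "mean_count p k n \<le> ennreal (exp (n * (real K * p)\<^sup>2)) * mean_count p k \<alpha>" if k: "k \<le> K" for k
  proof -
    have "n * p * \<beta> * real k - n * (real K * p)\<^sup>2 \<le> \<beta> * n * (real k * p - (real k * p)\<^sup>2)"
    proof -
      have "\<beta> * n * (real k * p)\<^sup>2 \<le> n * (real K * p)\<^sup>2"
        using k p n \<beta> by (intro mult_mono power_mono mult_right_mono) auto
      then show ?thesis by (simp add: algebra_simps)
    qed
    also have "\<dots> \<le> \<beta> * n * (1 - (1 - p) ^ k)"
      using one_minus_power_bounds(2)[of p k] p n \<beta> by (intro mult_left_mono) auto
    also have "\<dots> = (n - \<alpha>) * (1 - (1 - p) ^ k)" by (simp add: \<alpha>_def algebra_simps)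
    finally have "real k * (n * p * \<beta>) + - (n - \<alpha>) * (1 - (1 - p) ^ k) \<le> n * (real K * p)\<^sup>2"
      by (simp add: algebra_simps)
    then have "(n / \<alpha>) ^ k * exp (- (n - \<alpha>) * (1 - (1 - p) ^ k)) \<le> exp (n * (real K * p)\<^sup>2)"
      unfolding \<alpha>(2) exp_of_nat_mult[symmetric] exp_add[symmetric] by simp
    then show ?thesis
      using mean_count_intensity[OF n \<alpha>(1) p, of k] by (simp add: mult_right_mono ennreal_leI)
  qed
  then have "mean_small p K n \<le> ennreal (exp (n * (real K * p)\<^sup>2)) * mean_small p K \<alpha>"
    unfolding mean_small_eq sum_distrib_left
    by (intro sum_mono) (simp add: mult.left_commute mult_left_mono)
  also have "\<dots> \<le> ennreal (exp (n * (real K * p)\<^sup>2)) * ennreal \<alpha>"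
    by (intro mult_left_mono mean_small_le \<alpha>) simp
  finally show ?thesis using \<alpha>(1) by (simp add: ennreal_mult \<alpha>_def)
qed

section \<open>Tail bounds for the small mass and the number of vertices\<close>

text \<open>Chebyshev's inequality, the variance being at most \<open>t - s\<^sup>2\<close>.\<close>

lemma pmf_upper_tail_le:
  fixes X :: "'a \<Rightarrow> real"
  assumes nonneg: "\<And>x. 0 \<le> X x" and s: "(\<integral>\<^sup>+x. ennreal (X x) \<partial>measure_pmf M) = ennreal s" "0 \<le> s"
    and t: "(\<integral>\<^sup>+x. ennreal ((X x)\<^sup>2) \<partial>measure_pmf M) \<le> ennreal t" "0 \<le> t" and a: "0 < a"
  shows "measure_pmf.prob M {x. s + a \<le> X x} \<le> (t - s\<^sup>2) / a\<^sup>2"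
proof -
  have int: "integrable (measure_pmf M) X" "integrable (measure_pmf M) (\<lambda>x. (X x)\<^sup>2)"
    using nonneg s t by (auto intro!: integrableI_nonneg intro: order_le_less_trans)
  have E: "measure_pmf.expectation M X = s"
    using nonneg s by (subst integral_eq_nn_integral) simp_all
  have E2: "measure_pmf.expectation M (\<lambda>x. (X x)\<^sup>2) \<le> t"
    using t by (subst integral_eq_nn_integral) (simp_all add: enn2real_leI)
  have "measure_pmf.prob M {x. s + a \<le> X x} \<le> measure_pmf.prob M {x \<in> space (measure_pmf M). a \<le> \<bar>X x - measure_pmf.expectation M X\<bar>}"
    by (intro measure_pmf.finite_measure_mono) (auto simp: E)
  also have "\<dots> \<le> measure_pmf.variance M X / a\<^sup>2"
    using int a by (intro measure_pmf.Chebyshev_inequality) simp_all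
  also have "measure_pmf.variance M X = measure_pmf.expectation M (\<lambda>x. (X x)\<^sup>2) - s\<^sup>2"
    using measure_pmf.variance_eq[OF int] by (simp add: E)
  also have "(\<dots>) / a\<^sup>2 \<le> (t - s\<^sup>2) / a\<^sup>2" using E2 by (intro divide_right_mono) simp_all
  finally show ?thesis .
qed

lemma eventually_less_real: "\<forall>\<^sub>F n in sequentially. c < real n"
  using filterlim_real_sequentially by (simp add: filterlim_at_top_dense)

text \<open>For large \<open>n\<close>, duality puts the mean below
  \<open>(1 - 3 / 4 * \<beta>) * n\<close>, and the second moment bound makes the variance of
  smaller order than \<open>n\<^sup>2\<close>. Chebyshev's inequality then covers the gap of
  \<open>\<beta> / 4 * n\<close> up to the threshold.\<close>

lemma prob_small_mass_tendsto_0: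
  assumes c: "0 < c" and \<beta>: "0 < \<beta>" "\<beta> < 1" and dual: "exp (- (c * \<beta>)) = 1 - \<beta>"
  shows "(\<lambda>n. measure_pmf.prob (poisson_graph (real n) (c / real n))
     {(N, E). (1 - \<beta> / 2) * real n \<le> real (small_mass K {..<N} E)}) \<longlonglongrightarrow> 0"
proof -
  \<comment> \<open>The error exponent \<open>n * (K * p)\<^sup>2\<close> at
    \<open>p = c / n\<close>.\<close>
  define \<theta> where "\<theta> n = (real K * c)\<^sup>2 / real n" for n
  have \<theta>: "\<theta> \<longlonglongrightarrow> 0" unfolding \<theta>_def by (rule lim_const_over_n)
  \<comment> \<open>The variance bound \<open>K * n + (exp (\<theta> n) - 1) * n\<^sup>2\<close>,
    divided by the square of the gap \<open>\<beta> / 4 * n\<close>.\<close>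
  define bound where "bound n = (real K / real n + (exp (\<theta> n) - 1)) * (16 / \<beta>\<^sup>2)" for n
  have "bound \<longlonglongrightarrow> (0 + (exp 0 - 1)) * (16 / \<beta>\<^sup>2)"
    unfolding bound_def by (intro tendsto_intros \<theta> lim_const_over_n)
  then have lim: "bound \<longlonglongrightarrow> 0" by simp
  have "(\<lambda>n. exp (\<theta> n) * (1 - \<beta>)) \<longlonglongrightarrow> exp 0 * (1 - \<beta>)" by (intro tendsto_intros \<theta>)
  moreover have "exp 0 * (1 - \<beta>) < 1 - 3 / 4 * \<beta>" using \<beta> by simp
  ultimately have "\<forall>\<^sub>F n in sequentially. exp (\<theta> n) * (1 - \<beta>) < 1 - 3 / 4 * \<beta>"
    by (rule order_tendstoD)
  with eventually_less_real[of c] have "\<forall>\<^sub>F n in sequentially. measure_pmf.prob (poisson_graph (real n) (c / real n))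
     {(N, E). (1 - \<beta> / 2) * real n \<le> real (small_mass K {..<N} E)} \<le> bound n"
  proof eventually_elim
    case (elim n)
    let ?p = "c / real n"
    have n: "0 < real n" using c elim by simp
    have p: "0 \<le> ?p" "?p < 1" using c elim n by simp_all
    have \<theta>n: "real n * (real K * ?p)\<^sup>2 = \<theta> n" using n by (simp add: \<theta>_def power2_eq_square)
    obtain s where s: "mean_small ?p K (real n) = ennreal s" "0 \<le> s" "s \<le> real n"
      using mean_small_le[OF n, of ?p K] by (cases "mean_small ?p K (real n)") (auto simp: top_unique)
    have "mean_small ?p K (real n) \<le> ennreal (exp (\<theta> n) * ((1 - \<beta>) * real n))"
      using mean_small_dual_le[OF n p \<beta>, of K, unfolded \<theta>n] dual n by simp
    then have "s \<le> exp (\<theta> n) * ((1 - \<beta>) * real n)"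
      using s \<beta> n by (simp add: ennreal_le_iff)
    also have "\<dots> = exp (\<theta> n) * (1 - \<beta>) * real n" by simp
    also have "\<dots> \<le> (1 - 3 / 4 * \<beta>) * real n" using elim by (intro mult_right_mono) simp_all
    finally have s_le: "s + \<beta> / 4 * real n \<le> (1 - \<beta> / 2) * real n" by (simp add: algebra_simps)
    define t where "t = real K * s + exp (\<theta> n) * s\<^sup>2"
    have "(\<integral>\<^sup>+x. ennreal ((case x of (N, E) \<Rightarrow> real (small_mass K {..<N} E))\<^sup>2) \<partial>poisson_graph (real n) ?p)
      = (\<integral>\<^sup>+(N, E). of_nat ((small_mass K {..<N} E)\<^sup>2) \<partial>poisson_graph (real n) ?p)"
      by (intro nn_integral_cong) (auto simp: ennreal_of_nat_eq_real_of_nat)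
    also have "\<dots> \<le> of_nat K * mean_small ?p K (real n) + ennreal (exp (\<theta> n)) * (mean_small ?p K (real n))\<^sup>2"
      using second_moment_small_mass[OF n p, of K] by (simp only: \<theta>n)
    also have "\<dots> = ennreal t"
      using s(2) by (simp add: s(1) t_def ennreal_of_nat_eq_real_of_nat ennreal_mult ennreal_power)
    finally have t: "(\<integral>\<^sup>+x. ennreal ((case x of (N, E) \<Rightarrow> real (small_mass K {..<N} E))\<^sup>2) \<partial>poisson_graph (real n) ?p) \<le> ennreal t" .
    have s': "(\<integral>\<^sup>+x. ennreal (case x of (N, E) \<Rightarrow> real (small_mass K {..<N} E)) \<partial>poisson_graph (real n) ?p) = ennreal s"
      unfolding s(1)[symmetric] mean_small_def by (intro nn_integral_cong) (auto simp: ennreal_of_nat_eq_real_of_nat)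
    have "measure_pmf.prob (poisson_graph (real n) ?p) {(N, E). (1 - \<beta> / 2) * real n \<le> real (small_mass K {..<N} E)}
      \<le> measure_pmf.prob (poisson_graph (real n) ?p) {x. s + \<beta> / 4 * real n \<le> (case x of (N, E) \<Rightarrow> real (small_mass K {..<N} E))}"
      using s_le by (intro measure_pmf.finite_measure_mono) auto
    also have "\<dots> \<le> (t - s\<^sup>2) / (\<beta> / 4 * real n)\<^sup>2"
      using s(2) n \<beta> by (intro pmf_upper_tail_le s' t) (auto simp: t_def split: prod.split)
    also have "\<dots> \<le> (real K * real n + (exp (\<theta> n) - 1) * (real n)\<^sup>2) / (\<beta> / 4 * real n)\<^sup>2"
    proof (rule divide_right_mono)
      have "t - s\<^sup>2 = real K * s + (exp (\<theta> n) - 1) * s\<^sup>2" by (simp add: t_def algebra_simps)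
      also have "\<dots> \<le> real K * real n + (exp (\<theta> n) - 1) * (real n)\<^sup>2"
        using s by (intro add_mono mult_left_mono power_mono) (auto simp: \<theta>_def)
      finally show "t - s\<^sup>2 \<le> real K * real n + (exp (\<theta> n) - 1) * (real n)\<^sup>2" .
    qed simp
    also have "\<dots> = bound n"
      using n \<beta> by (simp add: bound_def field_simps power2_eq_square)
    finally show ?case .
  qed
  then show ?thesis
    by (intro tendsto_sandwich[OF _ _ tendsto_const lim]) simp_all
qed

text \<open>Chernoff's method: the indicator is at most \<open>b * (1 - \<delta>) ^ N\<close>, where
  \<open>1 - \<delta>\<close> is the optimal base, and the Poisson generating function yields the
  rate \<open>\<kappa>\<close>.\<close>

lemma prob_few_vertices_tendsto_0:
  assumes \<delta>: "0 < \<delta>" "\<delta> < 1"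
  shows "(\<lambda>n. measure_pmf.prob (poisson_graph (real n) (p n)) {(N, E). real N \<le> (1 - \<delta>) * real n}) \<longlonglongrightarrow> 0"
proof -
  define \<kappa> where "\<kappa> = \<delta> + (1 - \<delta>) * ln (1 - \<delta>)"
  \<comment> \<open>Since \<open>1 + \<delta> / (1 - \<delta>)\<close> is
    \<open>1 / (1 - \<delta>)\<close>, this strict inequality, multiplied by
    \<open>1 - \<delta>\<close>, says that \<open>\<kappa>\<close> is positive.\<close>
  have "ln (1 + \<delta> / (1 - \<delta>)) < \<delta> / (1 - \<delta>)" using \<delta> by (intro ln_add_one_self_less_self) simp
  also have "1 + \<delta> / (1 - \<delta>) = 1 / (1 - \<delta>)" using \<delta> by (simp add: field_simps)
  finally have "- ln (1 - \<delta>) < \<delta> / (1 - \<delta>)" using \<delta> by (simp add: ln_div)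
  then have \<kappa>: "0 < \<kappa>" using \<delta> by (simp add: \<kappa>_def field_simps)
  have lim: "(\<lambda>n. exp (- \<kappa>) ^ n) \<longlonglongrightarrow> 0" using \<kappa> by (intro LIMSEQ_realpow_zero) simp_all
  have "\<forall>\<^sub>F n in sequentially. measure_pmf.prob (poisson_graph (real n) (p n)) {(N, E). real N \<le> (1 - \<delta>) * real n} \<le> exp (- \<kappa>) ^ n"
    using eventually_less_real[of 0]
  proof eventually_elim
    case (elim n)
    define b where "b = exp (- (1 - \<delta>) * real n * ln (1 - \<delta>))"
    have "emeasure (measure_pmf (poisson_graph (real n) (p n))) {(N, E). real N \<le> (1 - \<delta>) * real n}
      = (\<integral>\<^sup>+x. indicator {(N, E). real N \<le> (1 - \<delta>) * real n} x \<partial>poisson_graph (real n) (p n))" by simp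
    also have "\<dots> \<le> (\<integral>\<^sup>+(N, E). ennreal b * ennreal ((1 - \<delta>) ^ N) \<partial>poisson_graph (real n) (p n))"
    proof (rule nn_integral_mono)
      fix x :: "nat \<times> nat set set"
      obtain N E where x: "x = (N, E)" by (cases x)
      have "1 \<le> b * (1 - \<delta>) ^ N" if "real N \<le> (1 - \<delta>) * real n"
      proof -
        have "(1 - \<delta>) ^ N = exp (real N * ln (1 - \<delta>))" using \<delta> by (simp add: exp_of_nat_mult)
        moreover have "(1 - \<delta>) * real n * ln (1 - \<delta>) \<le> real N * ln (1 - \<delta>)"
          using that \<delta> by (intro mult_right_mono_neg) simp_all
        ultimately show ?thesis by (simp add: b_def exp_add[symmetric] algebra_simps)
      qed
      then show "indicator {(N, E). real N \<le> (1 - \<delta>) * real n} x \<le> (case x of (N, E) \<Rightarrow> ennreal b * ennreal ((1 - \<delta>) ^ N))"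
        using \<delta> by (auto simp: x indicator_def b_def ennreal_mult[symmetric] simp flip: ennreal_1 intro!: ennreal_leI)
    qed
    also have "\<dots> = ennreal b * (\<integral>\<^sup>+N. ennreal ((1 - \<delta>) ^ N) \<partial>poisson_pmf (real n))"
      by (simp add: nn_integral_poisson_graph nn_integral_cmult)
    also have "\<dots> = ennreal b * ennreal (exp (real n * ((1 - \<delta>) - 1)))"
      using elim \<delta> by (subst nn_integral_poisson_power) simp_all
    also have "\<dots> = ennreal (exp (- \<kappa> * real n))"
      by (simp add: b_def ennreal_mult[symmetric] exp_add[symmetric] \<kappa>_def algebra_simps)
    also have "exp (- \<kappa> * real n) = exp (- \<kappa>) ^ n" by (simp only: exp_of_nat2_mult)
    finally show ?case by (simp add: measure_pmf.emeasure_eq_measure)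
  qed
  then show ?thesis
    by (intro tendsto_sandwich[OF _ _ tendsto_const lim]) simp_all
qed

section \<open>The rate function and the giant fraction\<close>

text \<open>The quotient is the slope of the chord from the origin of a strictly concave function;
  its derivative is negative by \<open>1 + L * x < exp (L * x)\<close>. Strictness makes the
  positive root of \<open>1 - exp (- c * t) - t\<close> unique and keeps the quotient different from
  1 elsewhere.\<close>

lemma exp_ratio_strict_decreasing:
  fixes L s t :: real
  assumes "0 < L" "0 < s" "s < t"
  shows "(1 - exp (- (L * t))) / t < (1 - exp (- (L * s))) / s"
proof (rule DERIV_neg_imp_decreasing[OF assms(3)])
  fix x assume x: "s \<le> x" "x \<le> t"
  then have x0: "0 < x" using assms by simp
  have "((\<lambda>x. (1 - exp (- (L * x))) / x) has_real_derivative
      (exp (- (L * x)) * L * x - (1 - exp (- (L * x)))) / (x * x)) (at x)"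
    using x0 by (auto intro!: derivative_eq_intros)
  moreover have "(1 + L * x) * exp (- (L * x)) < 1"
  proof -
    have "exp (ln (1 + L * x)) < exp (L * x)"
      using x0 assms by (intro exp_less_mono ln_add_one_self_less_self) simp
    then have "1 + L * x < exp (L * x)" using x0 assms by (simp add: add_pos_pos)
    then show ?thesis by (simp add: exp_minus field_simps)
  qed
  then have "(exp (- (L * x)) * L * x - (1 - exp (- (L * x)))) / (x * x) < 0"
    using x0 by (simp add: divide_neg_pos algebra_simps)
  ultimately show "\<exists>y. ((\<lambda>x. (1 - exp (- (L * x))) / x) has_real_derivative y) (at x) \<and> y < 0" by blast
qed

text \<open>The function grows in both directions away from its minimum at 1. Both cases follow from
  \<open>ln (y / x) \<le> y / x - 1\<close>, because \<open>y - x\<close> and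
  \<open>1 - 1 / x\<close> never have opposite signs.\<close>

lemma rate_function_mono:
  fixes x y :: real
  assumes "0 < x" "0 < y" "(1 \<le> x \<and> x \<le> y) \<or> (y \<le> x \<and> x \<le> 1)"
  shows "x - 1 - ln x \<le> y - 1 - ln y"
proof -
  have "ln y - ln x = ln (y / x)" using assms by (simp add: ln_div)
  also have "\<dots> \<le> y / x - 1" using assms by (intro ln_le_minus_one) simp
  finally have "ln y - ln x \<le> (y - x) / x" using assms by (simp add: field_simps)
  moreover have "(y - x) / x \<le> y - x"
  proof -
    have "0 \<le> (y - x) * (1 - 1 / x)"
      using assms(3)
    proof
      assume "1 \<le> x \<and> x \<le> y"
      then show ?thesis by (intro mult_nonneg_nonneg) simp_all
    next
      assume "y \<le> x \<and> x \<le> 1"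
      then show ?thesis using assms(1) by (intro mult_nonpos_nonpos) simp_all
    qed
    then show ?thesis by (simp add: algebra_simps)
  qed
  ultimately show ?thesis by simp
qed

lemma rate_function_pos:
  fixes x :: real
  assumes "0 < x" "x \<noteq> 1"
  shows "0 < x - 1 - ln x"
  using ln_le_minus_one[OF assms(1)] ln_eq_minus_one[OF assms(1)] assms(2) by force

text \<open>The intermediate value theorem gives a root in \<open>{a..1}\<close>. At every positive
  root the quotient of \<open>exp_ratio_strict_decreasing\<close> is 1, so there is no smaller one,
  and the root found is the value of \<open>LEAST\<close>.\<close>

lemma giant_fraction_properties:
  assumes c: "1 < c"
  shows "0 < giant_fraction c" "giant_fraction c < 1"
    "exp (- (c * giant_fraction c)) = 1 - giant_fraction c"
proof -
  define \<phi> where "\<phi> t = 1 - exp (- c * t) - t" for t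
  \<comment> \<open>With this \<open>a\<close> the bound
    \<open>exp (- x) \<le> 1 - x + x\<^sup>2\<close> gives
    \<open>\<phi> a \<ge> a * (c - 1) / 2\<close>.\<close>
  define a where "a = (c - 1) / (2 * c\<^sup>2)"
  have a: "0 < a" using c by (simp add: a_def)
  have "c - 1 \<le> c\<^sup>2" using c by (simp add: power2_eq_square) (smt (verit) mult_less_cancel_right2)
  then have a1: "a \<le> 1" using c by (simp add: a_def divide_simps)
  have "exp (- (c * a)) \<le> 1 - c * a + (c * a)\<^sup>2"
    using c a by (intro exp_minus_le_quadratic) simp
  moreover have "(c * a)\<^sup>2 = a * ((c - 1) / 2)" using c by (simp add: a_def power2_eq_square)
  moreover have "a * ((c - 1) / 2) \<le> a * (c - 1)" using a c by (intro mult_left_mono) simp_all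
  moreover have "a * (c - 1) = c * a - a" by (simp add: algebra_simps)
  ultimately have "0 \<le> \<phi> a" unfolding \<phi>_def mult_minus_left by linarith
  moreover have "\<phi> 1 \<le> 0" by (simp add: \<phi>_def)
  moreover have "continuous_on {a..1} \<phi>" unfolding \<phi>_def by (intro continuous_intros)
  ultimately obtain t where t: "a \<le> t" "t \<le> 1" "\<phi> t = 0"
    using IVT2'[of \<phi> 1 0 a] a1 by auto
  then have t0: "0 < t" using a by simp
  have ratio: "(1 - exp (- (c * u))) / u = 1" if "0 < u" "\<phi> u = 0" for u
    using that by (simp add: \<phi>_def)
  have "giant_fraction c = t"
    unfolding giant_fraction_def
  proof (rule Least_equality)
    show "0 < t \<and> 1 - exp (- c * t) - t = 0" using t t0 by (simp add: \<phi>_def)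
    fix u assume u: "0 < u \<and> 1 - exp (- c * u) - u = 0"
    show "t \<le> u"
    proof (rule ccontr)
      assume "\<not> t \<le> u"
      then have "(1 - exp (- (c * t))) / t < (1 - exp (- (c * u))) / u"
        using u c by (intro exp_ratio_strict_decreasing) simp_all
      moreover have "\<phi> u = 0" using u by (simp add: \<phi>_def)
      ultimately show False using ratio[OF t0 t(3)] ratio[of u] u by simp
    qed
  qed
  moreover have "t = 1 - exp (- (c * t))" using t(3) by (simp add: \<phi>_def)
  moreover from this have "t < 1" using exp_gt_zero[of "- (c * t)"] by linarith
  ultimately show "0 < giant_fraction c" "giant_fraction c < 1"
    "exp (- (c * giant_fraction c)) = 1 - giant_fraction c" using t0 by simp_all
qed

section \<open>From closed sets to component sizes\<close>

text \<open>Elements are added one at a time: when the sum first reaches \<open>t\<close>, it was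
  below \<open>t\<close> before, and the last weight is below \<open>t\<close> too.\<close>

lemma ex_subset_sum_between:
  fixes w :: "'a \<Rightarrow> nat" and t :: real
  assumes "finite S" "\<And>x. x \<in> S \<Longrightarrow> real (w x) < t" "0 < t" "t \<le> real (sum w S)"
  shows "\<exists>T\<subseteq>S. t \<le> real (sum w T) \<and> real (sum w T) < 2 * t"
  using assms
proof (induction S rule: finite_induct)
  case (insert x F)
  show ?case
  proof (cases "t \<le> real (sum w F)")
    case True
    then show ?thesis using insert by (meson insert_iff subset_insertI2)
  next
    case False
    then have "real (sum w (insert x F)) < 2 * t"
      using insert.hyps insert.prems(1)[of x] by simp
    then show ?thesis using insert.prems(3) by blast
  qed
qed simp

text \<open>The deterministic half of the argument: a graph outside the exceptional event of
  \<open>prob_coarse_closed_in_tendsto_0\<close>.\<close>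

locale sparse_bad_graph =
  fixes V :: "nat set" and E :: "nat set set" and K :: nat and bad :: "nat \<Rightarrow> bool"
  assumes V: "finite V" and E: "E \<subseteq> pairs V"
    and no_bad: "\<And>A. closed_in (V, E) A \<Longrightarrow> coarse K A (E \<inter> pairs A) \<Longrightarrow> \<not> bad (card A)"
begin

text \<open>Components are disjoint, so the only ones inside the union of \<open>\<D>\<close> are
  its members; hence the union is coarse.\<close>

lemma not_bad_sum:
  assumes "\<D> \<subseteq> components (V, E)" "\<And>C. C \<in> \<D> \<Longrightarrow> K \<le> card C"
  shows "\<not> bad (\<Sum>C\<in>\<D>. card C)"
proof -
  have cl: "closed_in (V, E) (\<Union>\<D>)" using closed_in_Union[of "(V, E)" \<D>] E assms(1) by simp
  have "K \<le> card C" if C: "C \<in> components (V, E)" "C \<subseteq> \<Union>\<D>" for C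
  proof -
    obtain u where "u \<in> C" using component_nonempty[OF C(1)] by auto
    with C(2) obtain D where D: "D \<in> \<D>" "u \<in> D" by auto
    with components_disjoint[OF C(1), of D] assms(1) \<open>u \<in> C\<close> have "C = D" by auto
    with D assms(2) show ?thesis by simp
  qed
  then have "coarse K (\<Union>\<D>) (E \<inter> pairs (\<Union>\<D>))" using coarse_closed_in[OF E cl] by simp
  from no_bad[OF cl this] show ?thesis
    using card_Union_components[of "(V, E)" \<D>] V assms(1) by simp
qed

end

lemma component_size_le_real:
  assumes "finite (fst G)" "\<D> \<subseteq> components G" "card \<D> < k" "0 \<le> x"
    and "\<And>C. C \<in> components G \<Longrightarrow> C \<notin> \<D> \<Longrightarrow> real (card C) \<le> x"
  shows "real (component_size k G) \<le> x"
proof -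
  have "component_size k G \<le> nat \<lfloor>x\<rfloor>"
    using assms by (intro component_size_le[of G \<D>]) (auto simp: le_nat_iff le_floor_iff)
  then show ?thesis using assms(4) by linarith
qed

text \<open>A component of size at least \<open>K\<close> is itself a coarse closed set, so its size
  is not bad; a smaller one is covered by the assumption on \<open>K\<close>.\<close>

lemma largest_component_small:
  assumes "sparse_bad_graph V E K (\<lambda>m. \<epsilon> * n \<le> real m)" and "real K \<le> \<epsilon> * n"
  shows "real (component_size 1 (V, E)) \<le> \<epsilon> * n"
proof -
  interpret sparse_bad_graph V E K "\<lambda>m. \<epsilon> * n \<le> real m" by fact
  have "real (card C) \<le> \<epsilon> * n" if "C \<in> components (V, E)" for C
    using not_bad_sum[of "{C}"] that assms(2) by (cases "K \<le> card C") auto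
  then show ?thesis
    using V assms(2) by (intro component_size_le_real[of _ "{}"]) auto
qed

text \<open>The components of size at least \<open>K\<close> together have at least
  \<open>\<epsilon> * n\<close> vertices, hence fewer than
  \<open>(\<beta> + \<epsilon>) * n\<close>. One of them reaches \<open>\<epsilon> * n\<close>, and
  so exceeds \<open>(\<beta> - \<epsilon>) * n\<close>, which leaves less than
  \<open>2 * \<epsilon> * n\<close> for any other.\<close>

lemma giant_component_sizes:
  assumes "sparse_bad_graph V E K (\<lambda>m. \<epsilon> * n \<le> real m \<and> (real m \<le> (\<beta> - \<epsilon>) * n \<or> (\<beta> + \<epsilon>) * n \<le> real m))"
    and K: "real K \<le> \<epsilon> * n" and n: "0 < n" and \<epsilon>: "0 < \<epsilon>" "3 * \<epsilon> \<le> \<beta>"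
    and large: "\<epsilon> * n \<le> real (card V) - real (small_mass K V E)"
  shows "\<bar>real (component_size 1 (V, E)) - \<beta> * n\<bar> \<le> \<epsilon> * n" "real (component_size 2 (V, E)) \<le> 2 * \<epsilon> * n"
proof -
  let ?bad = "\<lambda>m. \<epsilon> * n \<le> real m \<and> (real m \<le> (\<beta> - \<epsilon>) * n \<or> (\<beta> + \<epsilon>) * n \<le> real m)"
  interpret sparse_bad_graph V E K ?bad by fact
  have \<epsilon>n: "0 < \<epsilon> * n" and \<beta>n: "3 * (\<epsilon> * n) \<le> \<beta> * n"
    using n \<epsilon> mult_right_mono[OF \<epsilon>(2), of n] by simp_all
  define \<B> where "\<B> = {C \<in> components (V, E). K \<le> card C}"
  have fin: "finite (components (V, E))" using finite_components[of "(V, E)"] V by simp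
  then have fin\<B>: "finite \<B>" by (simp add: \<B>_def)
  have not_bad: "\<not> ?bad (\<Sum>C\<in>\<D>. card C)" if "\<D> \<subseteq> \<B>" for \<D>
    using that by (intro not_bad_sum) (auto simp: \<B>_def)
  have "card V = (\<Sum>C\<in>components (V, E). card C)"
    using card_Union_components[of "(V, E)" "components (V, E)"] V by (simp add: Union_components)
  also have "\<dots> = (\<Sum>C\<in>\<B>. card C) + (\<Sum>C\<in>components (V, E) - \<B>. card C)"
    using fin by (subst add.commute, intro sum.subset_diff) (auto simp: \<B>_def)
  also have "components (V, E) - \<B> = {C. C \<in> components (V, E) \<and> card C < K}" by (auto simp: \<B>_def)
  finally have total: "\<epsilon> * n \<le> real (\<Sum>C\<in>\<B>. card C)" using large by (simp add: small_mass_def)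
  with not_bad[of \<B>] have total_less: "real (\<Sum>C\<in>\<B>. card C) < (\<beta> + \<epsilon>) * n" by auto
  have "\<exists>C\<in>\<B>. \<epsilon> * n \<le> real (card C)"
  proof (rule ccontr)
    assume "\<not> (\<exists>C\<in>\<B>. \<epsilon> * n \<le> real (card C))"
    \<comment> \<open>Adding the components one at a time produces a sum in the window from
      \<open>\<epsilon> * n\<close> to \<open>2 * \<epsilon> * n\<close>. By
      \<open>3 * \<epsilon> \<le> \<beta>\<close> this window lies below
      \<open>(\<beta> - \<epsilon>) * n\<close>, among the bad sizes.\<close>
    then obtain \<D> where \<D>: "\<D> \<subseteq> \<B>" "\<epsilon> * n \<le> real (sum card \<D>)" "real (sum card \<D>) < 2 * (\<epsilon> * n)"
      using ex_subset_sum_between[OF fin\<B> _ \<epsilon>n total] by (auto simp: not_le)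
    then have "?bad (sum card \<D>)" using \<beta>n by (simp add: algebra_simps)
    with not_bad[OF \<D>(1)] show False by simp
  qed
  then obtain C where C: "C \<in> \<B>" "\<epsilon> * n \<le> real (card C)" by auto
  have C_comp: "C \<in> components (V, E)" using C by (simp add: \<B>_def)
  have C_lower: "(\<beta> - \<epsilon>) * n < real (card C)" using not_bad[of "{C}"] C by auto
  have C_upper: "real (card C) < (\<beta> + \<epsilon>) * n"
  proof -
    have "card C \<le> (\<Sum>C\<in>\<B>. card C)" using C(1) fin\<B> by (intro member_le_sum) auto
    with total_less show ?thesis by linarith
  qed
  have other: "real (card D) \<le> 2 * \<epsilon> * n" if D: "D \<in> components (V, E)" "D \<noteq> C" for D
  proof (cases "D \<in> \<B>")
    case True
    have "card C + card D = (\<Sum>C\<in>{C, D}. card C)" using D by simp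
    also have "\<dots> \<le> (\<Sum>C\<in>\<B>. card C)" using True C fin\<B> by (intro sum_mono2) auto
    finally have "real (card C) + real (card D) \<le> real (\<Sum>C\<in>\<B>. card C)" by linarith
    with total_less C_lower show ?thesis unfolding distrib_right left_diff_distrib by linarith
  next
    case False
    then show ?thesis using D K \<epsilon>n by (simp add: \<B>_def)
  qed
  show "real (component_size 2 (V, E)) \<le> 2 * \<epsilon> * n"
    using V C_comp other \<epsilon>n by (intro component_size_le_real[of _ "{C}"]) auto
  have "real (component_size 1 (V, E)) \<le> (\<beta> + \<epsilon>) * n"
  proof (rule component_size_le_real[of _ "{}"])
    fix D assume D: "D \<in> components (V, E)"
    show "real (card D) \<le> (\<beta> + \<epsilon>) * n"
      using other[OF D] C_upper \<beta>n \<epsilon>n by (cases "D = C") (simp_all add: algebra_simps)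
  qed (use V \<epsilon>n \<beta>n in \<open>simp_all add: algebra_simps\<close>)
  moreover have "card C \<le> component_size 1 (V, E)"
    using component_size_1_ge[of "(V, E)" C] V C_comp by simp
  ultimately show "\<bar>real (component_size 1 (V, E)) - \<beta> * n\<bar> \<le> \<epsilon> * n"
    using C_lower by (simp add: algebra_simps abs_le_iff)
qed

section \<open>The core in the sample space\<close>

lemma core_gpoi_graph: "core (gpoi_graph ((N, E), S)) = (Core ` {..<N}, (`) Core ` E)"
  by (auto simp: core_def induced_subgraph_def)

lemma core_component_size_eq:
  assumes "E \<subseteq> pairs {..<N}"
  shows "core_component_size k ((N, E), S) = real (component_size k ({..<N}, E))"
proof -
  have "E \<subseteq> Pow {..<N}" using assms by (auto simp: pairs_def)
  then show ?thesis
    unfolding core_component_size_def core_gpoi_graph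
    by (subst component_size_image) (simp_all add: inj_on_def)
qed

lemma gpoi_space_eq:
  "gpoi_space \<alpha> p = measure_pmf (poisson_graph \<alpha> p) \<Otimes>\<^sub>M (\<Pi>\<^sub>M i\<in>UNIV. measure_pmf (bernoulli_pmf p))"
  by (simp add: gpoi_space_def poisson_graph_def)

lemma prob_space_gpoi_space: "prob_space (gpoi_space \<alpha> p)"
proof -
  interpret S: prob_space "\<Pi>\<^sub>M i\<in>(UNIV :: (nat \<times> nat) set). measure_pmf (bernoulli_pmf p)"
    by (intro prob_space_PiM measure_pmf.prob_space_axioms)
  interpret pair_prob_space "measure_pmf (poisson_graph \<alpha> p)" "\<Pi>\<^sub>M i\<in>(UNIV :: (nat \<times> nat) set). measure_pmf (bernoulli_pmf p)" ..
  show ?thesis unfolding gpoi_space_eq by (rule prob_space_axioms)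
qed

text \<open>An event that ignores the stack is a rectangle whose second side is the whole space, of
  probability 1.\<close>

lemma measure_gpoi_space_fst:
  "measure (gpoi_space \<alpha> p) {\<omega> \<in> space (gpoi_space \<alpha> p). P (fst \<omega>)} = measure_pmf.prob (poisson_graph \<alpha> p) {x. P x}"
proof -
  let ?S = "\<Pi>\<^sub>M i\<in>(UNIV :: (nat \<times> nat) set). measure_pmf (bernoulli_pmf p)"
  interpret S: prob_space ?S
    by (intro prob_space_PiM measure_pmf.prob_space_axioms)
  have "{\<omega> \<in> space (gpoi_space \<alpha> p). P (fst \<omega>)} = {x. P x} \<times> space ?S"
    by (auto simp: gpoi_space_eq space_pair_measure)
  then have "emeasure (gpoi_space \<alpha> p) {\<omega> \<in> space (gpoi_space \<alpha> p). P (fst \<omega>)} = emeasure (measure_pmf (poisson_graph \<alpha> p)) {x. P x}"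
    by (simp add: gpoi_space_eq S.emeasure_pair_measure_Times S.emeasure_space_1)
  then show ?thesis by (simp add: measure_def)
qed

text \<open>The core does not see the stack, so the value depends on the first coordinate alone.
  Measurability then follows because that coordinate is discrete.\<close>

lemma core_component_size_fst: "core_component_size k \<omega> = core_component_size k (fst \<omega>, \<lambda>_. False)"
  by (cases \<omega>; cases "fst \<omega>") (simp add: core_component_size_def core_gpoi_graph del: gpoi_graph.simps)

lemma borel_measurable_core_component_size: "core_component_size k \<in> borel_measurable (gpoi_space \<alpha> p)"
proof -
  have "(\<lambda>x. core_component_size k (x, \<lambda>_. False)) \<circ> fst \<in> borel_measurable (gpoi_space \<alpha> p)"
    unfolding gpoi_space_eq by (intro measurable_comp[OF measurable_fst]) simp
  then show ?thesis by (simp add: comp_def flip: core_component_size_fst)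
qed

text \<open>The case \<open>b = 0\<close> covers plain smallness. The condition on \<open>E\<close>
  holds almost surely and is kept in the event so that deterministic statements apply. The division
  by \<open>n\<close> is undone for \<open>n > 0\<close>, hence an equality that holds
  eventually.\<close>

lemma small_o_in_probability_core:
  assumes "\<And>\<epsilon>. 0 < \<epsilon> \<Longrightarrow> (\<lambda>n. measure_pmf.prob (poisson_graph (real n) (c / real n))
     {(N, E). E \<subseteq> pairs {..<N} \<and> \<epsilon> * real n < \<bar>real (component_size k ({..<N}, E)) - b * real n\<bar>}) \<longlonglongrightarrow> 0"
  shows "small_o_in_probability (\<lambda>n. gpoi_space (real n) (c / real n)) (\<lambda>n \<omega>. core_component_size k \<omega> - b * real n)"
  unfolding small_o_in_probability_def tendsto_in_probability_def
proof (intro conjI allI impI)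
  fix n :: nat
  show "prob_space (gpoi_space (real n) (c / real n))" by (rule prob_space_gpoi_space)
  show "(\<lambda>\<omega>. (core_component_size k \<omega> - b * real n) / real n) \<in> borel_measurable (gpoi_space (real n) (c / real n))"
    using borel_measurable_core_component_size by measurable
next
  fix \<epsilon> :: real assume \<epsilon>: "0 < \<epsilon>"
  let ?P = "\<lambda>n x. \<epsilon> < \<bar>(core_component_size k (x, \<lambda>_. False) - b * real n) / real n - 0\<bar>"
  have "\<forall>\<^sub>F n in sequentially. measure_pmf.prob (poisson_graph (real n) (c / real n))
     {(N, E). E \<subseteq> pairs {..<N} \<and> \<epsilon> * real n < \<bar>real (component_size k ({..<N}, E)) - b * real n\<bar>}
     = measure (gpoi_space (real n) (c / real n))
        {\<omega> \<in> space (gpoi_space (real n) (c / real n)). \<epsilon> < \<bar>(core_component_size k \<omega> - b * real n) / real n - 0\<bar>}"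
    using eventually_less_real[of 0]
  proof eventually_elim
    case (elim n)
    have "measure (gpoi_space (real n) (c / real n))
        {\<omega> \<in> space (gpoi_space (real n) (c / real n)). \<epsilon> < \<bar>(core_component_size k \<omega> - b * real n) / real n - 0\<bar>}
      = measure_pmf.prob (poisson_graph (real n) (c / real n)) {x. ?P n x}"
      by (subst core_component_size_fst) (rule measure_gpoi_space_fst)
    also have "\<dots> = measure_pmf.prob (poisson_graph (real n) (c / real n))
        {(N, E). E \<subseteq> pairs {..<N} \<and> \<epsilon> * real n < \<bar>real (component_size k ({..<N}, E)) - b * real n\<bar>}"
    proof (intro measure_pmf.finite_measure_eq_AE AE_pmfI)
      fix x assume "x \<in> set_pmf (poisson_graph (real n) (c / real n))"
      then obtain N E where "x = (N, E)" "E \<subseteq> pairs {..<N}" by (cases x) (auto dest: set_poisson_graph)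
      then show "x \<in> {x. ?P n x} \<longleftrightarrow> x \<in> {(N, E). E \<subseteq> pairs {..<N} \<and> \<epsilon> * real n < \<bar>real (component_size k ({..<N}, E)) - b * real n\<bar>}"
        using elim by (simp add: core_component_size_eq abs_divide pos_less_divide_eq)
    qed simp_all
    finally show ?case ..
  qed
  from Lim_transform_eventually[OF assms[OF \<epsilon>] this]
  show "(\<lambda>n. measure (gpoi_space (real n) (c / real n))
        {\<omega> \<in> space (gpoi_space (real n) (c / real n)). \<epsilon> < \<bar>(core_component_size k \<omega> - b * real n) / real n - 0\<bar>}) \<longlonglongrightarrow> 0" .
qed

section \<open>Lower bounds on the rate in the two regimes\<close>

lemma eventually_mult_less_real:
  assumes "0 < \<epsilon>"
  shows "\<forall>\<^sub>F n in sequentially. a < \<epsilon> * real n"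
  using eventually_less_real[of "a / \<epsilon>"] by eventually_elim (use assms in \<open>simp add: field_simps\<close>)

text \<open>The argument \<open>x = n * (1 - (1 - c / n) ^ m) / m\<close> of the rate function is
  positive and at most \<open>c\<close> by Bernoulli's inequality, and below 1 the rate function
  decreases. The premise is repeated in the conclusion to fit the assumption \<open>bad\<close> of
  \<open>prob_coarse_closed_in_tendsto_0\<close>.\<close>

lemma subcritical_rate_bound:
  assumes c: "0 < c" "c < 1" and \<epsilon>: "0 < \<epsilon>"
  shows "\<forall>\<^sub>F n in sequentially. \<forall>m. \<epsilon> * real n \<le> real m \<longrightarrow> \<epsilon> * real n \<le> real m \<and>
      c - 1 - ln c \<le> real n * (1 - (1 - c / real n) ^ m) / real m - 1 - ln (real n * (1 - (1 - c / real n) ^ m) / real m)"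
  using eventually_less_real[of c]
proof eventually_elim
  case (elim n)
  show ?case
  proof (intro allI impI conjI)
    fix m assume m: "\<epsilon> * real n \<le> real m"
    have n: "0 < real n" using c elim by simp
    then have m0: "0 < m" using m \<epsilon> by (cases m) (auto simp: mult_le_0_iff)
    have p: "0 \<le> c / real n" "c / real n \<le> 1" "0 < c / real n" using c elim n by simp_all
    have "0 < real n * (1 - (1 - c / real n) ^ m) / real m"
      using p n m0 by (simp add: power_less_one_iff)
    moreover have "real n * (1 - (1 - c / real n) ^ m) / real m \<le> c"
      using one_minus_power_bounds(1)[OF p(1,2), of m] n m0 by (simp add: field_simps)
    ultimately show "c - 1 - ln c \<le> real n * (1 - (1 - c / real n) ^ m) / real m - 1 - ln (real n * (1 - (1 - c / real n) ^ m) / real m)"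
      using c by (intro rate_function_mono) simp_all
  qed
qed

text \<open>With \<open>s = m / n\<close>, the argument of the rate function is
  \<open>f (\<Lambda> n) s\<close>, where \<open>\<Lambda> n \<ge> c\<close> tends to
  \<open>c\<close>. As \<open>f c\<close> is strictly decreasing with value 1 at
  \<open>\<beta>\<close>, the argument stays away from 1 while \<open>s\<close> stays away from
  \<open>\<beta>\<close>.\<close>

lemma supercritical_rate_bound:
  assumes c: "0 < c" and \<beta>: "0 < \<beta>" "exp (- (c * \<beta>)) = 1 - \<beta>" and \<epsilon>: "0 < \<epsilon>" "\<epsilon> < \<beta>"
  obtains \<eta> where "0 < \<eta>" "\<forall>\<^sub>F n in sequentially. \<forall>m. \<epsilon> * real n \<le> real m \<and> (real m \<le> (\<beta> - \<epsilon>) * real n \<or> (\<beta> + \<epsilon>) * real n \<le> real m) \<longrightarrow>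
      \<epsilon> * real n \<le> real m \<and>
      \<eta> \<le> real n * (1 - (1 - c / real n) ^ m) / real m - 1 - ln (real n * (1 - (1 - c / real n) ^ m) / real m)"
proof -
  define f where "f L t = (1 - exp (- (L * t))) / t" for L t :: real
  define h where "h x = x - 1 - ln x" for x :: real
  define t0 t1 where "t0 = \<beta> + \<epsilon>" and "t1 = \<beta> - \<epsilon>"
  have t: "0 < t1" "t1 < \<beta>" "\<beta> < t0" using \<epsilon> by (simp_all add: t0_def t1_def)
  have f\<beta>: "f c \<beta> = 1" using \<beta> by (simp add: f_def)
  define x1 where "x1 = f c t1"
  have x1: "1 < x1" unfolding x1_def f\<beta>[symmetric] unfolding f_def
    using c t by (intro exp_ratio_strict_decreasing)
  have fc: "f c t0 < 1" unfolding f\<beta>[symmetric] unfolding f_def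
    using c \<beta> t by (intro exp_ratio_strict_decreasing)
  have fc0: "0 < f c t0" using c \<beta> t by (simp add: f_def)
  \<comment> \<open>The midpoint leaves room for replacing \<open>c\<close> by
    \<open>\<Lambda> n\<close> at \<open>t0\<close>. At \<open>t1\<close> the replacement only
    helps, since it increases \<open>f\<close> above \<open>x1\<close>.\<close>
  define x0 where "x0 = (f c t0 + 1) / 2"
  have x0: "f c t0 < x0" "x0 < 1" "0 < x0" using fc fc0 by (simp_all add: x0_def)
  define \<eta> where "\<eta> = min (h x0) (h x1)"
  have \<eta>: "0 < \<eta>" using rate_function_pos[of x0] rate_function_pos[of x1] x0 x1 by (simp add: \<eta>_def h_def)
  \<comment> \<open>The exact exponential rate:
    \<open>(1 - c / n) ^ m = exp (- (\<Lambda> n * (m / n)))\<close>.\<close>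
  define \<Lambda> where "\<Lambda> n = - (real n * ln (1 - c / real n))" for n
  have \<Lambda>: "\<Lambda> \<longlonglongrightarrow> c"
  proof -
    have "(\<lambda>n. ln ((1 + (- c) / real n) ^ n)) \<longlonglongrightarrow> ln (exp (- c))"
      by (intro tendsto_ln tendsto_exp_limit_sequentially) simp
    then have "(\<lambda>n. - ln ((1 + (- c) / real n) ^ n)) \<longlonglongrightarrow> c"
      using tendsto_minus by fastforce
    moreover have "\<forall>\<^sub>F n in sequentially. - ln ((1 + (- c) / real n) ^ n) = \<Lambda> n"
      using eventually_less_real[of c] by eventually_elim (use c in \<open>simp add: \<Lambda>_def ln_realpow\<close>)
    ultimately show ?thesis by (rule Lim_transform_eventually)
  qed
  have "(\<lambda>n. f (\<Lambda> n) t0) \<longlonglongrightarrow> f c t0" unfolding f_def using t \<beta> by (intro tendsto_intros \<Lambda>) simp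
  then have "\<forall>\<^sub>F n in sequentially. f (\<Lambda> n) t0 < x0" using x0 by (intro order_tendstoD)
  with eventually_less_real[of c]
  have "\<forall>\<^sub>F n in sequentially. \<forall>m. \<epsilon> * real n \<le> real m \<and> (real m \<le> (\<beta> - \<epsilon>) * real n \<or> (\<beta> + \<epsilon>) * real n \<le> real m) \<longrightarrow>
      \<epsilon> * real n \<le> real m \<and>
      \<eta> \<le> real n * (1 - (1 - c / real n) ^ m) / real m - 1 - ln (real n * (1 - (1 - c / real n) ^ m) / real m)"
  proof eventually_elim
    case (elim n)
    show ?case
    proof (intro allI impI)
      fix m assume m: "\<epsilon> * real n \<le> real m \<and> (real m \<le> (\<beta> - \<epsilon>) * real n \<or> (\<beta> + \<epsilon>) * real n \<le> real m)"
      have n: "0 < real n" using c elim by simp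
      then have m0: "0 < m" using m \<epsilon> by (cases m) (auto simp: mult_le_0_iff)
      define x where "x = real n * (1 - (1 - c / real n) ^ m) / real m"
      define s where "s = real m / real n"
      have s: "0 < s" using n m0 by (simp add: s_def)
      have p: "0 < 1 - c / real n" "1 - c / real n < 1" using c elim n by simp_all
      have "(1 - c / real n) ^ m = exp (real m * ln (1 - c / real n))" using p by (simp add: exp_of_nat_mult)
      also have "\<dots> = exp (- (\<Lambda> n * s))" using n by (simp add: \<Lambda>_def s_def)
      finally have x: "x = f (\<Lambda> n) s" using n m0 by (simp add: x_def f_def s_def)
      have "ln (1 - c / real n) \<le> - (c / real n)" using ln_le_minus_one[OF p(1)] by simp
      then have \<Lambda>c: "c \<le> \<Lambda> n" using n by (simp add: \<Lambda>_def field_simps)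
      have f_mono: "f (\<Lambda> n) v \<le> f (\<Lambda> n) u" if "0 < u" "u \<le> v" for u v
        using exp_ratio_strict_decreasing[of "\<Lambda> n" u v] that c \<Lambda>c unfolding f_def by (cases "u = v") auto
      have xpos: "0 < x" using s c \<Lambda>c by (simp add: x f_def)
      have "\<eta> \<le> h x"
      proof (cases "real m \<le> (\<beta> - \<epsilon>) * real n")
        case True
        then have "s \<le> t1" using n by (simp add: s_def t1_def field_simps)
        then have "f (\<Lambda> n) t1 \<le> x" unfolding x by (intro f_mono s)
        moreover have "x1 \<le> f (\<Lambda> n) t1"
          using \<Lambda>c t unfolding x1_def f_def by (intro divide_right_mono) simp_all
        ultimately have "h x1 \<le> h x" unfolding h_def using x1 xpos by (intro rate_function_mono) simp_all
        then show ?thesis by (simp add: \<eta>_def)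
      next
        case False
        with m have "t0 \<le> s" using n by (simp add: s_def t0_def field_simps)
        then have "x \<le> f (\<Lambda> n) t0" unfolding x using t \<beta> by (intro f_mono) simp_all
        then have "h x0 \<le> h x" unfolding h_def using x0 elim xpos by (intro rate_function_mono) simp_all
        then show ?thesis by (simp add: \<eta>_def)
      qed
      with m show "\<epsilon> * real n \<le> real m \<and>
        \<eta> \<le> real n * (1 - (1 - c / real n) ^ m) / real m - 1 - ln (real n * (1 - (1 - c / real n) ^ m) / real m)"
        by (simp add: h_def x_def)
    qed
  qed
  with \<eta> show thesis by (rule that)
qed

section \<open>The two regimes with high probability\<close>

lemma ex_nat_pos_ge: "\<exists>K :: nat. 0 < K \<and> (x :: real) \<le> real K"
proof -
  obtain K where "x < real K" using reals_Archimedean2 by blast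
  then have "0 < Suc K \<and> x \<le> real (Suc K)" by simp
  then show ?thesis by blast
qed

text \<open>All sizes from \<open>\<epsilon> * n\<close> on count as bad. Outside the exceptional
  event, \<open>largest_component_small\<close> applies as soon as
  \<open>K \<le> \<epsilon> * n\<close>.\<close>

lemma subcritical_whp:
  assumes c: "0 < c" "c < 1" and \<epsilon>: "0 < \<epsilon>"
  shows "(\<lambda>n. measure_pmf.prob (poisson_graph (real n) (c / real n))
     {(N, E). E \<subseteq> pairs {..<N} \<and> \<epsilon> * real n < real (component_size 1 ({..<N}, E))}) \<longlonglongrightarrow> 0"
proof -
  have \<eta>: "0 < c - 1 - ln c" using c by (intro rate_function_pos) simp_all
  obtain K where K: "0 < K" "2 / ((c - 1 - ln c) * (1 - exp (- c * \<epsilon>))) \<le> real K"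
    using ex_nat_pos_ge by blast
  let ?P = "\<lambda>n. measure_pmf.prob (poisson_graph (real n) (c / real n))"
  note lim = prob_coarse_closed_in_tendsto_0[OF c(1) \<epsilon> \<eta> K subcritical_rate_bound[OF c \<epsilon>]]
  have "\<forall>\<^sub>F n in sequentially. ?P n {(N, E). E \<subseteq> pairs {..<N} \<and> \<epsilon> * real n < real (component_size 1 ({..<N}, E))}
     \<le> ?P n {(N, E). \<exists>A. closed_in ({..<N}, E) A \<and> \<epsilon> * real n \<le> real (card A) \<and> coarse K A (E \<inter> pairs A)}"
    using eventually_mult_less_real[OF \<epsilon>, of "real K"]
  proof eventually_elim
    case (elim n)
    have "\<exists>A. closed_in ({..<N}, E) A \<and> \<epsilon> * real n \<le> real (card A) \<and> coarse K A (E \<inter> pairs A)"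
      if NE: "E \<subseteq> pairs {..<N}" "\<epsilon> * real n < real (component_size 1 ({..<N}, E))" for N :: nat and E
    proof (rule ccontr)
      assume "\<not> ?thesis"
      then have "sparse_bad_graph {..<N} E K (\<lambda>m. \<epsilon> * real n \<le> real m)"
        using NE(1) by unfold_locales auto
      from largest_component_small[OF this] elim NE(2) show False by simp
    qed
    then show ?case by (intro measure_pmf.finite_measure_mono) auto
  qed
  then show ?thesis
    by (intro tendsto_sandwich[OF _ _ tendsto_const lim]) simp_all
qed

text \<open>Three events of vanishing probability are excluded: a coarse closed set of bad size, too
  much small mass, too few vertices. Outside the last two, \<open>N\<close> minus the small mass
  exceeds \<open>\<beta> / 4 * n\<close>, which is at least \<open>\<epsilon> * n\<close>.\<close>

lemma supercritical_whp:
  assumes c: "1 < c" and \<epsilon>: "0 < \<epsilon>" "4 * \<epsilon> \<le> giant_fraction c"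
  shows "(\<lambda>n. measure_pmf.prob (poisson_graph (real n) (c / real n))
     {(N, E). E \<subseteq> pairs {..<N} \<and> \<not> (\<bar>real (component_size 1 ({..<N}, E)) - giant_fraction c * real n\<bar> \<le> \<epsilon> * real n \<and>
        real (component_size 2 ({..<N}, E)) \<le> 2 * \<epsilon> * real n)}) \<longlonglongrightarrow> 0"
proof -
  define \<beta> where "\<beta> = giant_fraction c"
  have c0: "0 < c" using c by simp
  have \<beta>: "0 < \<beta>" "\<beta> < 1" "exp (- (c * \<beta>)) = 1 - \<beta>"
    using giant_fraction_properties[OF c] by (simp_all add: \<beta>_def)
  have \<epsilon>\<beta>: "4 * \<epsilon> \<le> \<beta>" "\<epsilon> < \<beta>" using \<epsilon> by (simp_all add: \<beta>_def)
  define bad where "bad n m \<longleftrightarrow> \<epsilon> * real n \<le> real m \<and> (real m \<le> (\<beta> - \<epsilon>) * real n \<or> (\<beta> + \<epsilon>) * real n \<le> real m)" for n m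
  obtain \<eta> where \<eta>: "0 < \<eta>" and rate: "\<forall>\<^sub>F n in sequentially. \<forall>m. bad n m \<longrightarrow> \<epsilon> * real n \<le> real m \<and>
      \<eta> \<le> real n * (1 - (1 - c / real n) ^ m) / real m - 1 - ln (real n * (1 - (1 - c / real n) ^ m) / real m)"
    unfolding bad_def by (rule supercritical_rate_bound[OF c0 \<beta>(1,3) \<epsilon>(1) \<epsilon>\<beta>(2)])
  \<comment> \<open>The estimate for closed sets fixes \<open>K\<close>; the bound on the small mass
    holds for any fixed \<open>K\<close>, so for this one.\<close>
  obtain K where K: "0 < K" "2 / (\<eta> * (1 - exp (- c * \<epsilon>))) \<le> real K"
    using ex_nat_pos_ge by blast
  let ?P = "\<lambda>n. measure_pmf.prob (poisson_graph (real n) (c / real n))"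
  define S1 where "S1 n = {(N :: nat, E). \<exists>A. closed_in ({..<N}, E) A \<and> bad n (card A) \<and> coarse K A (E \<inter> pairs A)}" for n
  define S2 where "S2 n = {(N :: nat, E). (1 - \<beta> / 2) * real n \<le> real (small_mass K {..<N} E)}" for n
  define S3 where "S3 n = {(N, E :: nat set set). real N \<le> (1 - \<beta> / 4) * real n}" for n
  have "(\<lambda>n. ?P n (S1 n) + (?P n (S2 n) + ?P n (S3 n))) \<longlonglongrightarrow> 0 + (0 + 0)"
    unfolding S1_def S2_def S3_def
  proof (intro tendsto_add)
    show "(\<lambda>n. ?P n {(N, E). \<exists>A. closed_in ({..<N}, E) A \<and> bad n (card A) \<and> coarse K A (E \<inter> pairs A)}) \<longlonglongrightarrow> 0"
      by (rule prob_coarse_closed_in_tendsto_0[OF c0 \<epsilon>(1) \<eta> K rate])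
    show "(\<lambda>n. ?P n {(N, E). (1 - \<beta> / 2) * real n \<le> real (small_mass K {..<N} E)}) \<longlonglongrightarrow> 0"
      by (rule prob_small_mass_tendsto_0[OF c0 \<beta>])
    show "(\<lambda>n. ?P n {(N, E). real N \<le> (1 - \<beta> / 4) * real n}) \<longlonglongrightarrow> 0"
      using \<beta> by (intro prob_few_vertices_tendsto_0) simp_all
  qed
  then have lim: "(\<lambda>n. ?P n (S1 n) + (?P n (S2 n) + ?P n (S3 n))) \<longlonglongrightarrow> 0" by simp
  have "\<forall>\<^sub>F n in sequentially. ?P n {(N, E). E \<subseteq> pairs {..<N} \<and> \<not> (\<bar>real (component_size 1 ({..<N}, E)) - \<beta> * real n\<bar> \<le> \<epsilon> * real n \<and>
        real (component_size 2 ({..<N}, E)) \<le> 2 * \<epsilon> * real n)} \<le> ?P n (S1 n) + (?P n (S2 n) + ?P n (S3 n))"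
    using eventually_mult_less_real[OF \<epsilon>(1), of "real K"] eventually_less_real[of 0]
  proof eventually_elim
    case (elim n)
    have "(N, E) \<in> S1 n \<union> (S2 n \<union> S3 n)"
      if NE: "E \<subseteq> pairs {..<N}" "\<not> (\<bar>real (component_size 1 ({..<N}, E)) - \<beta> * real n\<bar> \<le> \<epsilon> * real n \<and>
        real (component_size 2 ({..<N}, E)) \<le> 2 * \<epsilon> * real n)" for N :: nat and E
    proof (rule ccontr)
      assume not: "(N, E) \<notin> S1 n \<union> (S2 n \<union> S3 n)"
      then have "sparse_bad_graph {..<N} E K (bad n)"
        using NE(1) by unfold_locales (auto simp: S1_def)
      moreover have "\<epsilon> * real n \<le> \<beta> / 4 * real n" using \<epsilon>\<beta> by (intro mult_right_mono) simp_all
      then have "\<epsilon> * real n \<le> real (card {..<N}) - real (small_mass K {..<N} E)"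
        using not by (simp add: S2_def S3_def algebra_simps)
      ultimately show False
        using giant_component_sizes[of "{..<N}" E K \<epsilon> "real n" \<beta>] elim NE(2) \<epsilon> \<epsilon>\<beta> unfolding bad_def by simp
    qed
    then have "?P n {(N, E). E \<subseteq> pairs {..<N} \<and> \<not> (\<bar>real (component_size 1 ({..<N}, E)) - \<beta> * real n\<bar> \<le> \<epsilon> * real n \<and>
        real (component_size 2 ({..<N}, E)) \<le> 2 * \<epsilon> * real n)} \<le> ?P n (S1 n \<union> (S2 n \<union> S3 n))"
      by (intro measure_pmf.finite_measure_mono) auto
    also have "\<dots> \<le> ?P n (S1 n) + ?P n (S2 n \<union> S3 n)"
      by (intro measure_Un_le) simp_all
    also have "\<dots> \<le> ?P n (S1 n) + (?P n (S2 n) + ?P n (S3 n))"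
      by (intro add_left_mono measure_Un_le) simp_all
    finally show ?case .
  qed
  then show ?thesis
    unfolding \<beta>_def[symmetric] by (intro tendsto_sandwich[OF _ _ tendsto_const lim]) simp_all
qed

theorem corollary3:
  fixes c :: real
  assumes "c > 0"
  shows "(c < 1 \<longrightarrow>
            small_o_in_probability (\<lambda>n. gpoi_space (real n) (c / real n))
              (\<lambda>n. core_component_size 1)) \<and>
         (c > 1 \<longrightarrow>
            small_o_in_probability (\<lambda>n. gpoi_space (real n) (c / real n))
              (\<lambda>n \<omega>. core_component_size 1 \<omega> - giant_fraction c * real n) \<and>
            small_o_in_probability (\<lambda>n. gpoi_space (real n) (c / real n))
              (\<lambda>n. core_component_size 2))"
proof (intro conjI impI)
  assume "c < 1"
  then show "small_o_in_probability (\<lambda>n. gpoi_space (real n) (c / real n)) (\<lambda>n. core_component_size 1)"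
    using small_o_in_probability_core[of c 1 0] subcritical_whp[OF assms] by simp
next
  assume c: "c > 1"
  let ?P = "\<lambda>n. measure_pmf.prob (poisson_graph (real n) (c / real n))"
  have \<beta>: "0 < giant_fraction c" by (rule giant_fraction_properties[OF c])
  show "small_o_in_probability (\<lambda>n. gpoi_space (real n) (c / real n)) (\<lambda>n \<omega>. core_component_size 1 \<omega> - giant_fraction c * real n)"
  proof (rule small_o_in_probability_core)
    fix \<delta> :: real assume \<delta>: "0 < \<delta>"
    \<comment> \<open>Capped to meet the condition of \<open>supercritical_whp\<close>; a smaller
      \<open>\<epsilon>\<close> only strengthens the bound on the size.\<close>
    define \<epsilon> where "\<epsilon> = min \<delta> (giant_fraction c / 4)"
    have \<epsilon>: "0 < \<epsilon>" "4 * \<epsilon> \<le> giant_fraction c" "\<epsilon> \<le> \<delta>" using \<delta> \<beta> by (auto simp: \<epsilon>_def)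
    have le: "\<epsilon> * real n \<le> \<delta> * real n" for n using \<epsilon> by (intro mult_right_mono) simp_all
    have "?P n {(N, E). E \<subseteq> pairs {..<N} \<and> \<delta> * real n < \<bar>real (component_size 1 ({..<N}, E)) - giant_fraction c * real n\<bar>}
      \<le> ?P n {(N, E). E \<subseteq> pairs {..<N} \<and> \<not> (\<bar>real (component_size 1 ({..<N}, E)) - giant_fraction c * real n\<bar> \<le> \<epsilon> * real n \<and>
        real (component_size 2 ({..<N}, E)) \<le> 2 * \<epsilon> * real n)}" for n
      using le[of n] by (intro measure_pmf.finite_measure_mono) auto
    then show "(\<lambda>n. ?P n {(N, E). E \<subseteq> pairs {..<N} \<and> \<delta> * real n < \<bar>real (component_size 1 ({..<N}, E)) - giant_fraction c * real n\<bar>}) \<longlonglongrightarrow> 0"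
      by (intro tendsto_sandwich[OF _ _ tendsto_const supercritical_whp[OF c \<epsilon>(1,2)]]) simp_all
  qed
  have "small_o_in_probability (\<lambda>n. gpoi_space (real n) (c / real n)) (\<lambda>n \<omega>. core_component_size 2 \<omega> - 0 * real n)"
  proof (rule small_o_in_probability_core)
    fix \<delta> :: real assume \<delta>: "0 < \<delta>"
    \<comment> \<open>Half of \<open>\<delta>\<close>, since the second largest component is bounded
      by \<open>2 * \<epsilon> * n\<close>.\<close>
    define \<epsilon> where "\<epsilon> = min (\<delta> / 2) (giant_fraction c / 4)"
    have \<epsilon>: "0 < \<epsilon>" "4 * \<epsilon> \<le> giant_fraction c" "2 * \<epsilon> \<le> \<delta>" using \<delta> \<beta> by (auto simp: \<epsilon>_def)
    have le: "2 * \<epsilon> * real n \<le> \<delta> * real n" for n using \<epsilon> by (intro mult_right_mono) simp_all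
    have "?P n {(N, E). E \<subseteq> pairs {..<N} \<and> \<delta> * real n < \<bar>real (component_size 2 ({..<N}, E)) - 0 * real n\<bar>}
      \<le> ?P n {(N, E). E \<subseteq> pairs {..<N} \<and> \<not> (\<bar>real (component_size 1 ({..<N}, E)) - giant_fraction c * real n\<bar> \<le> \<epsilon> * real n \<and>
        real (component_size 2 ({..<N}, E)) \<le> 2 * \<epsilon> * real n)}" for n
      using le[of n] by (intro measure_pmf.finite_measure_mono) auto
    then show "(\<lambda>n. ?P n {(N, E). E \<subseteq> pairs {..<N} \<and> \<delta> * real n < \<bar>real (component_size 2 ({..<N}, E)) - 0 * real n\<bar>}) \<longlonglongrightarrow> 0"
      by (intro tendsto_sandwich[OF _ _ tendsto_const supercritical_whp[OF c \<epsilon>(1,2)]]) simp_all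
  qed
  then show "small_o_in_probability (\<lambda>n. gpoi_space (real n) (c / real n)) (\<lambda>n. core_component_size 2)"
    by simp
qed

end
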